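(* There is an infinite branch piecewise linear map such that for all integers $k\ge 2$, its Lyapunov spectrum has its $k$-th order derivative equal to zero at infinitely many distinct points.
   Context: Infinite branch piecewise linear map: given a countably infinite collection $\{X_i\}_{i=1}^\infty$ of pairwise disjoint closed sub-intervals of $[0,1]$ with lengths $|X_i|>0$, an associated infinite branch piecewise linear map is a map $T:\bigcup_{i=1}^\infty X_i\to[0,1]$ whose restriction to each $X_i$ is an affine homeomorphism onto $[0,1]$ (so $|T'|=|X_i|^{-1}$ on $X_i$). Its invariant set is $X=\{x\in[0,1]:T^n(x)\in\bigcup_{i=1}^\infty X_i\text{ for all }n\ge0\}$, and $T$ is regarded as a dynamical system $T:X\to X$. Lyapunov spectrum: for $x\in X$ let $\lambda(x)=\lim_{n\to\infty}\frac1n\log|(T^n)'(x)|$ whenever this limit exists (as a real number), and let $A$ be the set of all values taken by $\lambda$ (an interval, unbounded above). The Lyapunov spectrum is $L:A\to\mathbb{R}$, $L(\alpha)=\dim_H\{x\in X:\lambda(x)\text{ exists and equals }\alpha\}$, where $\dim_H$ is Hausdorff dimension. Derivatives of $L$ are taken at points of the interior of $A$. *)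

theory Defs
  imports "HOL-Analysis.Analysis"
begin

section \<open>Hausdorff dimension\<close>

text \<open>Covers are sequences of bounded sets; finite covers are included because the empty set has
  diameter zero. Boundedness is required explicitly since \<^const>\<open>diameter\<close> is meaningless for
  unbounded sets.\<close>

definition hausdorff_cover :: "real \<Rightarrow> 'a::metric_space set \<Rightarrow> (nat \<Rightarrow> 'a set) \<Rightarrow> bool" where
  "hausdorff_cover \<delta> E U \<longleftrightarrow> E \<subseteq> (\<Union>i. U i) \<and> (\<forall>i. bounded (U i) \<and> diameter (U i) \<le> \<delta>)"

definition hausdorff_content :: "real \<Rightarrow> real \<Rightarrow> 'a::metric_space set \<Rightarrow> ennreal" where
  "hausdorff_content \<delta> s E =
     (INF U\<in>{U. hausdorff_cover \<delta> E U}. \<Sum>i. ennreal (diameter (U i) powr s))"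

definition hausdorff_measure :: "real \<Rightarrow> 'a::metric_space set \<Rightarrow> ennreal" where
  "hausdorff_measure s E = (SUP \<delta>\<in>{0<..}. hausdorff_content \<delta> s E)"

text \<open>Restricting to \<open>s > 0\<close> leaves the infimum unchanged and avoids any convention for
  the zeroth power of a zero diameter.\<close>

definition hausdorff_dim :: "'a::metric_space set \<Rightarrow> ennreal" where
  "hausdorff_dim E = (INF s\<in>{s. 0 < s \<and> hausdorff_measure s E = 0}. ennreal s)"

section \<open>Infinite branch piecewise linear maps\<close>

text \<open>The map is a total function on the reals; its values outside the union of the \<open>X i\<close>
  are irrelevant to everything below.\<close>

definition infinite_branch_pl_map :: "(nat \<Rightarrow> real set) \<Rightarrow> (real \<Rightarrow> real) \<Rightarrow> bool" where
  "infinite_branch_pl_map X T \<longleftrightarrow>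
     disjoint_family X \<and>
     (\<forall>i. (\<exists>a b. 0 \<le> a \<and> a < b \<and> b \<le> 1 \<and> X i = {a..b}) \<and>
          (\<exists>c d. \<forall>x\<in>X i. T x = c * x + d) \<and>
          (\<exists>g. homeomorphism (X i) {0..1} T g))"

definition invariant_set :: "(nat \<Rightarrow> real set) \<Rightarrow> (real \<Rightarrow> real) \<Rightarrow> real set" where
  "invariant_set X T = {x\<in>{0..1}. \<forall>n. (T ^^ n) x \<in> (\<Union>i. X i)}"

text \<open>An endpoint of one branch interval may be a limit of other branch intervals, where
  \<open>T\<close> need not be differentiable or even continuous on its whole domain. Derivatives are
  therefore taken along the branch of \<open>T ^^ n\<close> through the point, so that on \<open>X i\<close> the
  derivative of \<open>T\<close> is the slope of that branch, endpoints included.\<close>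

definition branch_domain :: "(nat \<Rightarrow> real set) \<Rightarrow> (real \<Rightarrow> real) \<Rightarrow> nat \<Rightarrow> real \<Rightarrow> real set" where
  "branch_domain X T n x = {y. \<forall>k<n. \<exists>i. (T ^^ k) x \<in> X i \<and> (T ^^ k) y \<in> X i}"

definition iterate_deriv :: "(nat \<Rightarrow> real set) \<Rightarrow> (real \<Rightarrow> real) \<Rightarrow> nat \<Rightarrow> real \<Rightarrow> real" where
  "iterate_deriv X T n x = vector_derivative (T ^^ n) (at x within branch_domain X T n x)"

section \<open>Lyapunov spectrum\<close>

definition has_lyapunov_exponent ::
    "(nat \<Rightarrow> real set) \<Rightarrow> (real \<Rightarrow> real) \<Rightarrow> real \<Rightarrow> real \<Rightarrow> bool" where
  "has_lyapunov_exponent X T x \<alpha> \<longleftrightarrow>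
     (\<lambda>n. 1 / real n * ln \<bar>iterate_deriv X T n x\<bar>) \<longlonglongrightarrow> \<alpha>"

definition lyapunov_values :: "(nat \<Rightarrow> real set) \<Rightarrow> (real \<Rightarrow> real) \<Rightarrow> real set" where
  "lyapunov_values X T = {\<alpha>. \<exists>x\<in>invariant_set X T. has_lyapunov_exponent X T x \<alpha>}"

definition lyapunov_spectrum :: "(nat \<Rightarrow> real set) \<Rightarrow> (real \<Rightarrow> real) \<Rightarrow> real \<Rightarrow> real" where
  "lyapunov_spectrum X T \<alpha> =
     enn2real (hausdorff_dim {x\<in>invariant_set X T. has_lyapunov_exponent X T x \<alpha>})"

section \<open>Higher derivatives\<close>

text \<open>Since \<^const>\<open>deriv\<close> is total, existence of the derivatives is recorded separately: the
  \<open>n\<close>-th derivative must exist throughout a neighbourhood of \<open>x\<close> and be differentiable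
  at \<open>x\<close> for the derivative of order \<open>n + 1\<close> to exist at \<open>x\<close>.\<close>

fun times_differentiable_at :: "nat \<Rightarrow> (real \<Rightarrow> real) \<Rightarrow> real \<Rightarrow> bool" where
  "times_differentiable_at 0 f x \<longleftrightarrow> True"
| "times_differentiable_at (Suc n) f x \<longleftrightarrow>
     (\<forall>\<^sub>F y in nhds x. times_differentiable_at n f y) \<and>
     (deriv ^^ n) f field_differentiable (at x)"

end

theory Submission
  imports Defs "HOL-Probability.Probability"
begin

text \<open>
  Let \<open>r i\<close> be the lengths of the branches, \<open>Z t = (\<Sum>i. r i powr t)\<close>, and let the pressure be
  \<open>p = ln Z\<close>. If \<open>Z t < \<infinity>\<close> for every \<open>t > 0\<close>, then \<open>p\<close> is smooth and strictly convex on \<open>(0, \<infinity>)\<close>,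
  and \<open>- p' t\<close> increases to \<open>\<infinity>\<close> as \<open>t\<close> decreases to \<open>0\<close>.

  \<^bold>\<open>The spectrum.\<close> At \<open>\<alpha> = - p' t\<close> with \<open>p t > 0\<close> the spectrum is \<open>L \<alpha> = t + p t / \<alpha>\<close>
  (\<open>lyapunov_spectrum_mean\<close>). For the upper bound, the points with exponent \<open>\<alpha>\<close> lie in cylinders of
  level \<open>n\<close> and length about \<open>exp (- n \<alpha>)\<close>, and the \<open>t\<close>-th powers of the lengths of all cylinders of
  level \<open>n\<close> add up to \<open>Z t ^ n\<close>. For the lower bound, finitely many branches carry a Bernoulli
  measure with weights proportional to \<open>r i powr u\<close>, where \<open>u\<close> is close to \<open>t\<close> and is chosen so that
  almost every point has exponent exactly \<open>\<alpha>\<close>. Finitely many branches have gaps between them, so the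
  points of a small set that are coded by these branches lie in one cylinder whose length is at most
  a constant times the diameter of the set, and the mass distribution principle applies
  (\<open>hausdorff_measure_level_ne_0\<close>).

  \<^bold>\<open>Inflections.\<close> Differentiating the formula gives \<open>L' = - p / \<alpha>\<^sup>2\<close> and
  \<open>L'' = (2 p p'' - p'\<^sup>2) / (\<alpha>^3 p'')\<close>, where \<open>p\<close> and its derivatives are taken at \<open>t\<close>. The numerator
  has the sign of the second derivative of \<open>sqrt p\<close>. Since \<open>L\<close> is positive and strictly decreasing
  for large \<open>\<alpha>\<close>, it is not concave on any half-line. If \<open>sqrt p\<close> is not convex on any interval
  \<open>(0, \<epsilon>)\<close>, then \<open>L\<close> is not convex on any half-line either, and \<open>L''\<close> has arbitrarily large zeros. By
  Rolle's theorem every further derivative of \<open>L\<close> then has arbitrarily large zeros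
  (\<open>infinite_zeros_of_higher_derivs\<close>).

  \<^bold>\<open>The example.\<close> The lengths come in blocks: nearly \<open>2 ^ block_exp k\<close> branches have the same
  length \<open>2 powr - depth k\<close>. The blocks grow so fast that for \<open>t\<close> between \<open>s\<close> and \<open>9 s\<close>, where
  \<open>s = crit_scale k\<close>, the \<open>k\<close>-th block accounts for nearly all of \<open>Z t\<close>. So \<open>p\<close> is nearly affine
  there, and it falls by a factor of nine. The square root of an affine function with such a drop
  lies well above its chord, which defeats the convexity of \<open>sqrt p\<close>
  (\<open>sqrt_pressure_not_midpoint_convex\<close>).
\<close>

section \<open>Hausdorff measure and dimension\<close>

lemma hausdorff_measure_eq_0_I:
  assumes "\<And>\<delta> \<epsilon>. 0 < \<delta> \<Longrightarrow> 0 < \<epsilon> \<Longrightarrow>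
     \<exists>U. hausdorff_cover \<delta> E U \<and> (\<Sum>i. ennreal (diameter (U i) powr s)) \<le> ennreal \<epsilon>"
  shows "hausdorff_measure s E = 0"
proof -
  have "hausdorff_content \<delta> s E \<le> 0" if "0 < \<delta>" for \<delta>
  proof (rule ennreal_le_epsilon)
    fix \<epsilon> :: real assume "0 < \<epsilon>"
    from assms[OF \<open>0 < \<delta>\<close> this] obtain U where "hausdorff_cover \<delta> E U"
      and "(\<Sum>i. ennreal (diameter (U i) powr s)) \<le> ennreal \<epsilon>" by blast
    then have "hausdorff_content \<delta> s E \<le> ennreal \<epsilon>"
      unfolding hausdorff_content_def by (intro INF_lower2[of U]) simp_all
    then show "hausdorff_content \<delta> s E \<le> 0 + ennreal \<epsilon>" by simp
  qed
  then have "hausdorff_measure s E \<le> 0"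
    unfolding hausdorff_measure_def by (intro SUP_least) simp
  then show ?thesis by simp
qed

lemma hausdorff_measure_eq_0_D:
  assumes "hausdorff_measure s E = 0" "0 < \<delta>" "0 < (\<epsilon>::ennreal)"
  obtains U where "hausdorff_cover \<delta> E U" "(\<Sum>i. ennreal (diameter (U i) powr s)) < \<epsilon>"
proof -
  have "hausdorff_content \<delta> s E \<le> 0"
    using assms(1,2) unfolding hausdorff_measure_def
    by (metis (no_types, lifting) SUP_upper greaterThan_iff)
  then have "hausdorff_content \<delta> s E < \<epsilon>"
    using assms(3) by (auto intro: le_less_trans)
  then show ?thesis
    using that unfolding hausdorff_content_def by (auto simp: INF_less_iff)
qed

lemma hausdorff_dim_eqI:
  assumes "0 < v"
    and upper: "\<And>s. v < s \<Longrightarrow> hausdorff_measure s E = 0"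
    and lower: "\<And>s. 0 < s \<Longrightarrow> s < v \<Longrightarrow> hausdorff_measure s E \<noteq> 0"
  shows "hausdorff_dim E = ennreal v"
proof (rule antisym)
  show "hausdorff_dim E \<le> ennreal v"
  proof (rule ennreal_le_epsilon)
    fix e :: real assume "0 < e"
    have "hausdorff_dim E \<le> ennreal (v + e)"
      unfolding hausdorff_dim_def
      by (rule INF_lower) (use \<open>0 < e\<close> \<open>0 < v\<close> upper in auto)
    then show "hausdorff_dim E \<le> ennreal v + ennreal e"
      using \<open>0 < e\<close> \<open>0 < v\<close> by (simp add: ennreal_plus)
  qed
  show "ennreal v \<le> hausdorff_dim E"
    unfolding hausdorff_dim_def
    by (rule INF_greatest) (use lower not_le in \<open>auto intro!: ennreal_leI\<close>)
qed

section \<open>Full branch systems and their symbolic coding\<close>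

locale full_branch_system =
  fixes r a :: "nat \<Rightarrow> real"
  assumes r_pos: "0 < r i" and r_less_1: "r i < 1"
    and a_nonneg: "0 \<le> a i" and right_end_le_1: "a i + r i \<le> 1"
    and disjoint_branches: "i \<noteq> j \<Longrightarrow> {a i..a i + r i} \<inter> {a j..a j + r j} = {}"
begin

definition X :: "nat \<Rightarrow> real set" where
  "X i = {a i..a i + r i}"

text \<open>Outside the branches the description yields an unspecified index; \<open>T\<close> is only used on them.\<close>

definition T :: "real \<Rightarrow> real" where
  "T x = (x - a (THE i. x \<in> X i)) / r (THE i. x \<in> X i)"

text \<open>The logarithm of the slope of the \<open>i\<close>-th branch.\<close>

definition rate :: "nat \<Rightarrow> real" where
  "rate i = - ln (r i)"

lemma rate_pos: "0 < rate i"
  using r_pos[of i] r_less_1[of i] by (simp add: rate_def)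

lemma X_unique: "x \<in> X i \<Longrightarrow> x \<in> X j \<Longrightarrow> i = j"
  using disjoint_branches[of i j] unfolding X_def by blast

lemma T_on_branch: "x \<in> X i \<Longrightarrow> T x = (x - a i) / r i"
proof -
  assume "x \<in> X i"
  then have "(THE i. x \<in> X i) = i" by (blast intro: the_equality X_unique)
  then show ?thesis by (simp add: T_def)
qed

lemma infinite_branch_pl_map: "infinite_branch_pl_map X T"
proof -
  have "disjoint_family X"
    using disjoint_branches by (simp add: disjoint_family_on_def X_def)
  moreover have "\<exists>a b. 0 \<le> a \<and> a < b \<and> b \<le> 1 \<and> X i = {a..b}" for i
    using a_nonneg[of i] right_end_le_1[of i] r_pos[of i] by (auto simp: X_def intro!: exI)
  moreover have "\<exists>c d. \<forall>x\<in>X i. T x = c * x + d" for i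
    by (rule exI[of _ "1 / r i"], rule exI[of _ "- a i / r i"])
      (simp add: T_on_branch field_simps diff_divide_distrib)
  moreover have "\<exists>g. homeomorphism (X i) {0..1} T g" for i
  proof (rule exI, rule homeomorphismI)
    have "continuous_on (X i) (\<lambda>x. (x - a i) / r i)"
      using r_pos[of i] by (intro continuous_intros) auto
    then show "continuous_on (X i) T"
      by (rule continuous_on_eq) (simp add: T_on_branch)
    show "continuous_on {0..1} (\<lambda>y. a i + r i * y)" by (intro continuous_intros)
    have inX: "a i + r i * y \<in> X i" if "y \<in> {0..1}" for y
      using that r_pos[of i] by (auto simp: X_def)
    then show "(\<lambda>y. a i + r i * y) ` {0..1} \<subseteq> X i" by auto
    show "T ` X i \<subseteq> {0..1}"
      using r_pos[of i] by (auto simp: T_on_branch) (auto simp: X_def field_simps)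
    show "a i + r i * T x = x" if "x \<in> X i" for x
      using that r_pos[of i] by (simp add: T_on_branch)
    show "T (a i + r i * y) = y" if "y \<in> {0..1}" for y
      using inX[OF that] r_pos[of i] by (simp add: T_on_branch)
  qed
  ultimately show ?thesis unfolding infinite_branch_pl_map_def by blast
qed

text \<open>The points whose first \<open>n\<close> iterates lie in the branches \<open>\<omega> 0, \<dots>, \<omega> (n - 1)\<close> form the
  interval \<open>cyl n \<omega>\<close>; \<open>offset\<close> is its left end and \<open>scale\<close> its length.\<close>

definition scale :: "nat \<Rightarrow> (nat \<Rightarrow> nat) \<Rightarrow> real" where
  "scale n \<omega> = (\<Prod>j<n. r (\<omega> j))"

definition offset :: "nat \<Rightarrow> (nat \<Rightarrow> nat) \<Rightarrow> real" where
  "offset n \<omega> = (\<Sum>k<n. a (\<omega> k) * scale k \<omega>)"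

definition cyl :: "nat \<Rightarrow> (nat \<Rightarrow> nat) \<Rightarrow> real set" where
  "cyl n \<omega> = {offset n \<omega>..offset n \<omega> + scale n \<omega>}"

lemma scale_pos: "0 < scale n \<omega>"
  unfolding scale_def by (intro prod_pos) (simp add: r_pos)

lemma scale_Suc: "scale (Suc n) \<omega> = scale n \<omega> * r (\<omega> n)"
  by (simp add: scale_def)

lemma offset_Suc: "offset (Suc n) \<omega> = offset n \<omega> + a (\<omega> n) * scale n \<omega>"
  by (simp add: offset_def)

lemma scale_exp: "scale n \<omega> = exp (- (\<Sum>j<n. rate (\<omega> j)))"
  unfolding scale_def rate_def by (simp add: sum_negf exp_sum r_pos)

lemma scale_cong: "(\<And>j. j < n \<Longrightarrow> \<omega> j = \<omega>' j) \<Longrightarrow> scale n \<omega> = scale n \<omega>'"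
  unfolding scale_def by (intro prod.cong) auto

lemma cyl_cong:
  assumes "\<And>j. j < n \<Longrightarrow> \<omega> j = \<omega>' j"
  shows "cyl n \<omega> = cyl n \<omega>'"
proof -
  have "offset n \<omega> = offset n \<omega>'"
    unfolding offset_def by (intro sum.cong) (auto simp: assms intro!: scale_cong)
  then show ?thesis using scale_cong[of n \<omega> \<omega>'] assms by (simp add: cyl_def)
qed

lemma mem_cyl_Suc:
  "x \<in> cyl (Suc n) \<omega> \<longleftrightarrow> x \<in> cyl n \<omega> \<and> (x - offset n \<omega>) / scale n \<omega> \<in> X (\<omega> n)"
proof -
  let ?s = "scale n \<omega>" and ?i = "\<omega> n"
  have s: "0 < ?s" by (rule scale_pos)
  have "0 \<le> a ?i * ?s" "a ?i * ?s + ?s * r ?i \<le> ?s"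
    using a_nonneg[of ?i] s right_end_le_1[of ?i] mult_right_mono[of "a ?i + r ?i" 1 ?s]
    by (auto simp: algebra_simps)
  with s show ?thesis
    by (auto simp: cyl_def X_def offset_Suc scale_Suc field_simps)
qed

text \<open>Going from left to right along the code avoids shifts: \<open>T ^^ n\<close> maps \<open>cyl n \<omega>\<close> affinely
  onto \<open>{0..1}\<close>, so the next symbol is read off from the rescaled position of the point.\<close>

lemma mem_cyl_iff:
  "x \<in> cyl n \<omega> \<longleftrightarrow> x \<in> {0..1} \<and> (\<forall>k<n. (T ^^ k) x \<in> X (\<omega> k))" (is ?A)
  and funpow_T_on_cyl: "(\<forall>k<n. (T ^^ k) x \<in> X (\<omega> k)) \<Longrightarrow> (T ^^ n) x = (x - offset n \<omega>) / scale n \<omega>"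
    (is "_ \<Longrightarrow> ?B")
proof -
  have *: "(T ^^ n) x = (x - offset n \<omega>) / scale n \<omega>" if "\<forall>k<n. (T ^^ k) x \<in> X (\<omega> k)" for n
    using that
  proof (induction n)
    case 0 show ?case by (simp add: offset_def scale_def)
  next
    case (Suc n)
    then have eq: "(T ^^ n) x = (x - offset n \<omega>) / scale n \<omega>" and "(T ^^ n) x \<in> X (\<omega> n)" by auto
    then have "(T ^^ Suc n) x = ((x - offset n \<omega>) / scale n \<omega> - a (\<omega> n)) / r (\<omega> n)"
      by (simp add: T_on_branch)
    also have "\<dots> = (x - offset (Suc n) \<omega>) / scale (Suc n) \<omega>"
      using scale_pos[of n \<omega>] r_pos[of "\<omega> n"] by (simp add: scale_Suc offset_Suc field_simps)
    finally show ?case .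
  qed
  then show "(\<forall>k<n. (T ^^ k) x \<in> X (\<omega> k)) \<Longrightarrow> ?B" .
  show ?A
  proof (induction n)
    case 0 show ?case by (simp add: cyl_def offset_def scale_def)
  next
    case (Suc n)
    have "x \<in> cyl (Suc n) \<omega> \<longleftrightarrow> x \<in> {0..1} \<and> (\<forall>k<n. (T ^^ k) x \<in> X (\<omega> k)) \<and> (x - offset n \<omega>) / scale n \<omega> \<in> X (\<omega> n)"
      unfolding mem_cyl_Suc Suc by blast
    also have "\<dots> \<longleftrightarrow> x \<in> {0..1} \<and> (\<forall>k<n. (T ^^ k) x \<in> X (\<omega> k)) \<and> (T ^^ n) x \<in> X (\<omega> n)"
      using *[of n] by auto
    finally show ?case by (auto simp: less_Suc_eq)
  qed
qed

definition code_point :: "(nat \<Rightarrow> nat) \<Rightarrow> real" where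
  "code_point \<omega> = (\<Sum>k. a (\<omega> k) * scale k \<omega>)"

text \<open>The intervals \<open>cyl n \<omega>\<close> are nested, so every partial sum \<open>offset m \<omega>\<close> stays below the right
  end of \<open>cyl n \<omega>\<close>. This also shows that the series converges.\<close>

lemma code_point_in_cyl: "code_point \<omega> \<in> cyl n \<omega>"
proof -
  have nonneg: "0 \<le> a (\<omega> k) * scale k \<omega>" for k
    using a_nonneg[of "\<omega> k"] scale_pos[of k \<omega>] by simp
  have dec: "offset (n + m) \<omega> + scale (n + m) \<omega> \<le> offset n \<omega> + scale n \<omega>" for n m
  proof (induction m)
    case (Suc m)
    have "a (\<omega> (n + m)) * scale (n + m) \<omega> + scale (n + m) \<omega> * r (\<omega> (n + m)) \<le> scale (n + m) \<omega>"
      using right_end_le_1[of "\<omega> (n + m)"] scale_pos[of "n + m" \<omega>]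
        mult_right_mono[of "a (\<omega> (n + m)) + r (\<omega> (n + m))" 1 "scale (n + m) \<omega>"]
      by (simp add: algebra_simps)
    with Suc show ?case by (simp add: offset_Suc scale_Suc)
  qed simp
  have summ: "summable (\<lambda>k. a (\<omega> k) * scale k \<omega>)"
  proof (rule summableI_nonneg_bounded)
    show "(\<Sum>k<m. a (\<omega> k) * scale k \<omega>) \<le> 1" for m
      using dec[of 0 m] scale_pos[of m \<omega>] by (simp add: offset_def scale_def)
  qed (rule nonneg)
  have "offset n \<omega> \<le> code_point \<omega>"
    unfolding offset_def code_point_def by (intro sum_le_suminf summ) (auto intro: nonneg)
  moreover have "code_point \<omega> \<le> offset n \<omega> + scale n \<omega>"
    unfolding code_point_def
  proof (rule suminf_le_const[OF summ])
    fix m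
    have "(\<Sum>k<m. a (\<omega> k) * scale k \<omega>) \<le> offset (n + m) \<omega>"
      unfolding offset_def by (intro sum_mono2) (auto intro: nonneg)
    also have "\<dots> \<le> offset n \<omega> + scale n \<omega>"
      using dec[of n m] scale_pos[of "n + m" \<omega>] by simp
    finally show "(\<Sum>k<m. a (\<omega> k) * scale k \<omega>) \<le> offset n \<omega> + scale n \<omega>" .
  qed
  ultimately show ?thesis by (simp add: cyl_def)
qed

lemma invariant_set_iff: "x \<in> invariant_set X T \<longleftrightarrow> (\<exists>\<omega>. \<forall>n. x \<in> cyl n \<omega>)"
proof
  assume "x \<in> invariant_set X T"
  then have x: "x \<in> {0..1}" and "\<forall>n. \<exists>i. (T ^^ n) x \<in> X i"
    by (auto simp: invariant_set_def)
  then obtain \<omega> where "\<And>n. (T ^^ n) x \<in> X (\<omega> n)" by metis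
  with x show "\<exists>\<omega>. \<forall>n. x \<in> cyl n \<omega>" by (auto simp: mem_cyl_iff)
next
  assume "\<exists>\<omega>. \<forall>n. x \<in> cyl n \<omega>"
  then show "x \<in> invariant_set X T"
    unfolding mem_cyl_iff invariant_set_def by blast
qed

text \<open>The branch domain contains the nondegenerate interval \<open>cyl n \<omega>\<close>, on which \<open>T ^^ n\<close> is affine;
  hence the derivative is unique, even at an end of the interval.\<close>

lemma iterate_deriv_cyl:
  assumes x: "x \<in> cyl n \<omega>"
  shows "iterate_deriv X T n x = 1 / scale n \<omega>"
proof -
  let ?D = "branch_domain X T n x"
  have s: "0 < scale n \<omega>" by (rule scale_pos)
  have D: "y \<in> ?D \<longleftrightarrow> (\<forall>k<n. (T ^^ k) y \<in> X (\<omega> k))" for y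
    using x X_unique unfolding mem_cyl_iff branch_domain_def by blast
  have sub: "cyl n \<omega> \<subseteq> ?D" by (auto simp: D mem_cyl_iff)
  have "x islimpt cyl n \<omega>"
    using x s by (simp add: cyl_def)
  then have "x islimpt ?D" by (rule islimpt_subset[OF _ sub])
  then have nt: "at x within ?D \<noteq> bot" by (simp add: trivial_limit_within)
  have "((\<lambda>y. (y - offset n \<omega>) / scale n \<omega>) has_vector_derivative 1 / scale n \<omega>) (at x within ?D)"
    unfolding has_real_derivative_iff_has_vector_derivative[symmetric]
    using s by (auto intro!: derivative_eq_intros)
  then have "((T ^^ n) has_vector_derivative 1 / scale n \<omega>) (at x within ?D)"
    by (rule has_vector_derivative_transform[rotated 2])
      (use x sub in \<open>auto simp: D funpow_T_on_cyl\<close>)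
  then show ?thesis
    unfolding iterate_deriv_def by (rule vector_derivative_within[OF nt])
qed

lemma has_lyapunov_exponent_iff:
  assumes "\<And>n. x \<in> cyl n \<omega>"
  shows "has_lyapunov_exponent X T x \<alpha> \<longleftrightarrow> (\<lambda>n. (\<Sum>j<n. rate (\<omega> j)) / real n) \<longlonglongrightarrow> \<alpha>"
proof -
  have "(\<lambda>n. 1 / real n * ln \<bar>iterate_deriv X T n x\<bar>) = (\<lambda>n. (\<Sum>j<n. rate (\<omega> j)) / real n)"
    unfolding iterate_deriv_cyl[OF assms] by (simp add: scale_exp ln_div)
  then show ?thesis unfolding has_lyapunov_exponent_def by simp
qed

definition level :: "real \<Rightarrow> real set" where
  "level \<alpha> = {x\<in>invariant_set X T. has_lyapunov_exponent X T x \<alpha>}"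

lemma code_point_in_level:
  assumes "(\<lambda>n. (\<Sum>j<n. rate (\<omega> j)) / real n) \<longlonglongrightarrow> \<alpha>"
  shows "code_point \<omega> \<in> level \<alpha>"
  using assms code_point_in_cyl has_lyapunov_exponent_iff[of "code_point \<omega>" \<omega> \<alpha>]
  unfolding level_def invariant_set_iff by blast

end

section \<open>Covers by cylinders: the upper bound for the dimension\<close>

text \<open>Applied with \<open>g i = r i powr t\<close>, this evaluates the sum of the \<open>t\<close>-th powers of the lengths
  of all cylinders of level \<open>n\<close> over finitely many branches.\<close>

lemma sum_words_prod:
  fixes g :: "'a \<Rightarrow> 'b::comm_semiring_1"
  assumes "finite A"
  shows "(\<Sum>w | set w \<subseteq> A \<and> length w = n. \<Prod>j<n. g (w ! j)) = (\<Sum>i\<in>A. g i) ^ n"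
proof (induction n)
  case 0
  have "{w::'a list. set w \<subseteq> A \<and> length w = 0} = {[]}" by auto
  then show ?case by (simp del: length_0_conv)
next
  case (Suc n)
  let ?W = "{w. set w \<subseteq> A \<and> length w = n}"
  have "(\<Sum>w | set w \<subseteq> A \<and> length w = Suc n. \<Prod>j<Suc n. g (w ! j))
      = (\<Sum>(w, i)\<in>?W \<times> A. \<Prod>j<Suc n. g ((i # w) ! j))"
    unfolding lists_length_Suc_eq
    by (subst sum.reindex) (auto simp: inj_on_def case_prod_beta)
  also have "\<dots> = (\<Sum>(w, i)\<in>?W \<times> A. (\<Prod>j<n. g (w ! j)) * g i)"
    by (intro sum.cong) (auto simp: prod.lessThan_Suc_shift mult.commute simp del: prod.lessThan_Suc)
  also have "\<dots> = (\<Sum>w\<in>?W. \<Prod>j<n. g (w ! j)) * (\<Sum>i\<in>A. g i)"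
    by (simp add: sum_product sum.cartesian_product)
  finally show ?case by (simp add: Suc.IH mult.commute)
qed

lemma diameter_real_interval: "a \<le> (b::real) \<Longrightarrow> diameter {a..b} = b - a"
  by (simp add: diameter_closed_interval)

lemma sum_geometric_le:
  assumes "0 \<le> (q::real)" "q < 1"
  shows "(\<Sum>m=M..<M'. q ^ m) \<le> q ^ M / (1 - q)"
proof (cases "M \<le> M'")
  case True
  then have "(1 - q) * (\<Sum>m=M..<M'. q ^ m) = q ^ M - q ^ M'"
  proof (induction M' rule: dec_induct)
    case (step n)
    have "(1 - q) * (\<Sum>m=M..<Suc n. q ^ m) = (1 - q) * (\<Sum>m=M..<n. q ^ m) + (1 - q) * q ^ n"
      using step.hyps by (simp add: distrib_left)
    then show ?case by (simp only: step.IH) (simp add: left_diff_distrib)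
  qed simp
  also have "\<dots> \<le> q ^ M" using assms by simp
  finally show ?thesis using assms by (simp add: field_simps)
qed (use assms in auto)

context full_branch_system
begin

lemma diameter_cyl: "diameter (cyl n \<omega>) = scale n \<omega>"
  unfolding cyl_def using scale_pos[of n \<omega>] by (subst diameter_real_interval) auto

text \<open>Choose \<open>\<beta> < \<alpha>\<close> with \<open>ln F < \<beta> (s - t)\<close>. Every point of the level set lies in cylinders of
  arbitrarily high level \<open>n\<close> and length \<open>\<sigma> \<le> exp (- \<beta> n)\<close>. For these,
  \<open>\<sigma> powr s \<le> \<sigma> powr t * exp (- \<beta> (s - t)) ^ n\<close>, and summing over all of level \<open>n\<close> gives at most
  \<open>(F * exp (- \<beta> (s - t))) ^ n\<close>, the term of a convergent geometric series.\<close>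

lemma hausdorff_measure_level_eq_0:
  assumes summ: "summable (\<lambda>i. r i powr t)" and F: "F = (\<Sum>i. r i powr t)" "1 \<le> F"
    and "0 < \<alpha>" and s: "t + ln F / \<alpha> < s"
  shows "hausdorff_measure s (level \<alpha>) = 0"
proof (rule hausdorff_measure_eq_0_I)
  fix \<delta> \<epsilon> :: real assume "0 < \<delta>" "0 < \<epsilon>"
  have lnF: "0 \<le> ln F" using F(2) by simp
  then have "t < s" using s \<open>0 < \<alpha>\<close> by (smt (verit) divide_nonneg_pos)
  then have "ln F / (s - t) < \<alpha>" using s \<open>0 < \<alpha>\<close> by (simp add: field_simps)
  then obtain \<beta> where \<beta>: "ln F / (s - t) < \<beta>" "\<beta> < \<alpha>" using dense by blast
  then have "0 < \<beta>" using lnF \<open>t < s\<close> by (smt (verit) divide_nonneg_pos)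
  \<comment> \<open>The ratio of the geometric series of cylinder sums.\<close>
  define q where "q = F * exp (- \<beta> * (s - t))"
  have "0 < q" using F(2) by (simp add: q_def)
  have "F < exp (\<beta> * (s - t))"
    using \<beta>(1) \<open>t < s\<close> F(2) by (subst ln_less_cancel_iff[symmetric]) (auto simp: field_simps)
  then have "q < 1"
    by (simp add: q_def exp_minus inverse_eq_divide pos_divide_less_eq)
  have "(\<lambda>m. exp (- \<beta>) ^ m) \<longlonglongrightarrow> 0" "(\<lambda>m. q ^ m / (1 - q)) \<longlonglongrightarrow> 0 / (1 - q)"
    using \<open>0 < \<beta>\<close> \<open>0 < q\<close> \<open>q < 1\<close> by (auto intro!: tendsto_intros LIMSEQ_power_zero)
  then have "\<forall>\<^sub>F m in sequentially. exp (- \<beta>) ^ m < \<delta> \<and> q ^ m / (1 - q) < \<epsilon>"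
    using \<open>0 < \<delta>\<close> \<open>0 < \<epsilon>\<close> by (auto intro!: eventually_conj dest: order_tendstoD)
  then obtain M where M: "exp (- \<beta>) ^ M < \<delta>" "q ^ M / (1 - q) < \<epsilon>"
    by (auto simp: eventually_sequentially)
  define good where
    "good w \<longleftrightarrow> M \<le> length w \<and> scale (length w) (nth w) \<le> exp (- \<beta> * length w)" for w
  obtain e :: "nat \<Rightarrow> nat list" where e: "bij e"
    using countableE_infinite[of "UNIV :: nat list set"] infinite_UNIV_listI
    by (metis bij_betw_inv countableI_type)
  define U where "U k = (if good (e k) then cyl (length (e k)) (nth (e k)) else {})" for k
  have "hausdorff_cover \<delta> (level \<alpha>) U"
    unfolding hausdorff_cover_def
  proof (intro conjI allI subsetI)
    fix x assume "x \<in> level \<alpha>"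
    then obtain \<omega> where \<omega>: "\<And>n. x \<in> cyl n \<omega>" and "has_lyapunov_exponent X T x \<alpha>"
      unfolding level_def invariant_set_iff by blast
    then have "(\<lambda>n. (\<Sum>j<n. rate (\<omega> j)) / real n) \<longlonglongrightarrow> \<alpha>"
      by (simp add: has_lyapunov_exponent_iff[OF \<omega>])
    then have "\<forall>\<^sub>F n in sequentially. \<beta> < (\<Sum>j<n. rate (\<omega> j)) / real n \<and> 0 < n \<and> M \<le> n"
      using \<beta>(2) by (intro eventually_conj order_tendstoD(1) eventually_gt_at_top eventually_ge_at_top)
    from eventually_happens[OF this] obtain n
      where n: "\<beta> < (\<Sum>j<n. rate (\<omega> j)) / real n" "0 < n" "M \<le> n" by auto
    let ?w = "map \<omega> [0..<n]"
    have "scale n \<omega> \<le> exp (- \<beta> * n)"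
      using n by (simp add: scale_exp field_simps)
    moreover have "scale n (nth ?w) = scale n \<omega>" "cyl n (nth ?w) = cyl n \<omega>"
      by (auto intro!: scale_cong cyl_cong)
    ultimately have "good ?w" "x \<in> cyl (length ?w) (nth ?w)"
      using \<omega>[of n] n by (auto simp: good_def)
    moreover obtain k where "e k = ?w" using e by (metis bij_pointE)
    ultimately have "x \<in> U k" by (simp add: U_def)
    then show "x \<in> (\<Union>k. U k)" by blast
  next
    fix k
    show "bounded (U k)" by (simp add: U_def cyl_def)
    show "diameter (U k) \<le> \<delta>"
    proof (cases "good (e k)")
      case True
      then have "diameter (U k) \<le> exp (- \<beta>) ^ length (e k)"
        unfolding U_def good_def
        by (simp add: diameter_cyl exp_of_nat2_mult[symmetric] mult.commute)
      also have "\<dots> \<le> exp (- \<beta>) ^ M"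
        using True \<open>0 < \<beta>\<close> by (intro power_decreasing) (auto simp: good_def)
      finally show ?thesis using M by simp
    qed (use \<open>0 < \<delta>\<close> in \<open>simp add: U_def\<close>)
  qed
  moreover have "(\<Sum>k. ennreal (diameter (U k) powr s)) \<le> ennreal \<epsilon>"
  proof (rule suminf_le_const)
    fix K
    define g where "g w = (if good w then scale (length w) (nth w) powr s else 0)" for w
    have g_bound: "g w \<le> (\<Prod>j<length w. r (w ! j) powr t) * exp (- \<beta> * (s - t)) ^ length w" for w
    proof (cases "good w")
      case True
      let ?n = "length w" and ?\<sigma> = "scale (length w) (nth w)"
      have "?\<sigma> powr s = ?\<sigma> powr t * ?\<sigma> powr (s - t)" by (simp add: powr_add[symmetric])
      also have "?\<sigma> powr (s - t) \<le> exp (- \<beta> * ?n) powr (s - t)"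
        using True \<open>t < s\<close> scale_pos[of ?n "nth w"] by (intro powr_mono2) (auto simp: good_def)
      also have "exp (- \<beta> * ?n) powr (s - t) = exp (- \<beta> * (s - t)) ^ ?n"
        by (simp add: exp_powr_real exp_of_nat_mult[symmetric] mult_ac)
      also have "?\<sigma> powr t = (\<Prod>j<?n. r (w ! j) powr t)"
        unfolding scale_def by (rule prod_powr_distrib)
      finally show ?thesis using True by (simp add: g_def mult_left_mono)
    qed (auto simp: g_def intro!: mult_nonneg_nonneg prod_nonneg)
    \<comment> \<open>A finite part of the cover uses only words over \<open>N\<close> letters and of length below \<open>M'\<close>.\<close>
    define N where "N = Suc (Max (insert 0 (\<Union>k<K. set (e k))))"
    define M' where "M' = Suc (Max (insert 0 ((\<lambda>k. length (e k)) ` {..<K})))"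
    let ?W = "\<lambda>m. {w. set w \<subseteq> {..<N} \<and> length w = m}"
    have N: "set (e k) \<subseteq> {..<N}" if "k < K" for k
    proof
      fix i assume "i \<in> set (e k)"
      then have "i \<le> Max (insert 0 (\<Union>k<K. set (e k)))" using that by (intro Max_ge) auto
      then show "i \<in> {..<N}" by (simp add: N_def)
    qed
    have M': "length (e k) < M'" if "k < K" for k
    proof -
      have "length (e k) \<le> Max (insert 0 ((\<lambda>k. length (e k)) ` {..<K}))"
        using that by (intro Max_ge) auto
      then show ?thesis by (simp add: M'_def)
    qed
    have fin: "finite (?W m)" for m by (rule finite_lists_length_eq) simp
    have "(\<Sum>k<K. diameter (U k) powr s) = (\<Sum>k<K. g (e k))"
      by (intro sum.cong) (auto simp: U_def g_def diameter_cyl)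
    also have "\<dots> = (\<Sum>w\<in>e ` {..<K}. g w)"
      using e by (subst sum.reindex) (auto simp: bij_def inj_on_def)
    also have "\<dots> = (\<Sum>w\<in>{w\<in>e ` {..<K}. good w}. g w)"
      by (intro sum.mono_neutral_right) (auto simp: g_def)
    also have "\<dots> \<le> (\<Sum>w\<in>(\<Union>m\<in>{M..<M'}. ?W m). g w)"
      by (intro sum_mono2) (use N M' fin in \<open>auto simp: good_def g_def\<close>)
    also have "\<dots> = (\<Sum>m=M..<M'. \<Sum>w\<in>?W m. g w)"
      by (intro sum.UNION_disjoint) (use fin in auto)
    also have "\<dots> \<le> (\<Sum>m=M..<M'. q ^ m)"
    proof (rule sum_mono)
      fix m
      have "(\<Sum>w\<in>?W m. g w) \<le> (\<Sum>w\<in>?W m. (\<Prod>j<m. r (w ! j) powr t) * exp (- \<beta> * (s - t)) ^ m)"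
        by (intro sum_mono) (use g_bound in auto)
      also have "\<dots> = (\<Sum>i<N. r i powr t) ^ m * exp (- \<beta> * (s - t)) ^ m"
        by (simp add: sum_distrib_right[symmetric]
              sum_words_prod[of "{..<N}" "\<lambda>i. r i powr t"])
      also have "\<dots> \<le> F ^ m * exp (- \<beta> * (s - t)) ^ m"
        unfolding F(1)
        by (intro mult_right_mono power_mono sum_le_suminf summ sum_nonneg) auto
      also have "\<dots> = q ^ m" by (simp add: q_def power_mult_distrib)
      finally show "(\<Sum>w\<in>?W m. g w) \<le> q ^ m" .
    qed
    also have "\<dots> \<le> q ^ M / (1 - q)"
      using sum_geometric_le[of q M M'] \<open>0 < q\<close> \<open>q < 1\<close> by simp
    finally have "(\<Sum>k<K. diameter (U k) powr s) \<le> \<epsilon>" using M by simp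
    then show "(\<Sum>k<K. ennreal (diameter (U k) powr s)) \<le> ennreal \<epsilon>"
      by (simp add: ennreal_leI sum_ennreal)
  qed simp
  ultimately show "\<exists>U. hausdorff_cover \<delta> (level \<alpha>) U \<and> (\<Sum>i. ennreal (diameter (U i) powr s)) \<le> ennreal \<epsilon>"
    by blast
qed

end

section \<open>Bernoulli measures: the lower bound for the dimension\<close>

lemma indep_vars_PiM_coordinates:
  fixes N :: "nat \<Rightarrow> 'a measure"
  assumes "\<And>i. prob_space (N i)"
  shows "prob_space.indep_vars (PiM UNIV N) N (\<lambda>i \<omega>. \<omega> i) UNIV"
proof -
  interpret product_prob_space N UNIV by (intro product_prob_spaceI assms)
  have "distr (PiM UNIV N) (PiM UNIV N) (\<lambda>x. \<lambda>i\<in>UNIV. x i) = (\<Pi>\<^sub>M i\<in>UNIV. distr (PiM UNIV N) (N i) (\<lambda>\<omega>. \<omega> i))"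
    by (simp add: PiM_component restrict_UNIV distr_id)
  then show ?thesis
    by (subst indep_vars_iff_distr_eq_PiM') auto
qed

text \<open>The strong law of large numbers for bounded independent identically distributed variables:
  Hoeffding's inequality makes the probabilities of large deviations summable, and the Borel-Cantelli
  lemma concludes.\<close>

lemma AE_average_tendsto_expectation:
  fixes p :: "'a pmf" and f :: "'a \<Rightarrow> real"
  assumes f: "\<And>x. x \<in> set_pmf p \<Longrightarrow> f x \<in> {lo..hi}" and "lo < hi"
  shows "AE \<omega> in PiM UNIV (\<lambda>_::nat. measure_pmf p).
           (\<lambda>n. (\<Sum>j<n. f (\<omega> j)) / real n) \<longlonglongrightarrow> measure_pmf.expectation p f"
proof -
  let ?N = "\<lambda>_::nat. measure_pmf p"
  let ?\<mu> = "measure_pmf.expectation p f"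
  define M where "M = PiM UNIV ?N"
  interpret product_prob_space ?N UNIV
    by (intro product_prob_spaceI) (rule measure_pmf.prob_space_axioms)
  have M_prob: "prob_space M" unfolding M_def by (rule P.prob_space_axioms)
  interpret MM: prob_space M by (rule M_prob)
  have comp[measurable]: "(\<lambda>\<omega>. \<omega> i) \<in> measurable M (count_space UNIV)" for i
    unfolding M_def by (rule measurable_compose[OF measurable_component_singleton]) auto
  have rv[measurable]: "(\<lambda>\<omega>. f (\<omega> i)) \<in> borel_measurable M" for i
    by (rule measurable_compose[OF comp]) simp
  have distr_comp: "distr M (measure_pmf p) (\<lambda>\<omega>. \<omega> i) = measure_pmf p" for i
    unfolding M_def using PiM_component[of i] by simp
  have indep: "MM.indep_vars (\<lambda>_. borel) (\<lambda>i \<omega>. f (\<omega> i)) I" for I :: "nat set"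
  proof -
    have "MM.indep_vars ?N (\<lambda>i \<omega>. \<omega> i) UNIV"
      unfolding M_def by (rule indep_vars_PiM_coordinates) (rule measure_pmf.prob_space_axioms)
    then have "MM.indep_vars ?N (\<lambda>i \<omega>. \<omega> i) I" by (rule MM.indep_vars_subset) simp
    then show ?thesis by (rule MM.indep_vars_compose2[where Y="\<lambda>_. f"]) simp
  qed
  have AE_f: "AE \<omega> in M. f (\<omega> i) \<in> {lo..hi}" for i
    unfolding M_def
    by (rule AE_component[of i "\<lambda>x. f x \<in> {lo..hi}"]) (use f in \<open>auto simp: AE_measure_pmf_iff\<close>)
  have expect: "MM.expectation (\<lambda>\<omega>. f (\<omega> i)) = ?\<mu>" for i
  proof -
    have "MM.expectation (\<lambda>\<omega>. f (\<omega> i)) = integral\<^sup>L (distr M (measure_pmf p) (\<lambda>\<omega>. \<omega> i)) f"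
      using measurable_component_singleton[of i UNIV ?N] unfolding M_def
      by (subst integral_distr) auto
    then show ?thesis by (simp add: distr_comp)
  qed
  define A where "A e n = {\<omega>\<in>space M. e \<le> \<bar>(\<Sum>j<n. f (\<omega> j)) / real n - ?\<mu>\<bar>}" for e :: real and n
  have A_sets[measurable]: "A e n \<in> sets M" for e n unfolding A_def by measurable
  have A_bound: "measure M (A e n) \<le> 2 * exp (- 2 * e\<^sup>2 / (hi - lo)\<^sup>2) ^ n" if "0 < e" "0 < n" for e n
  proof -
    interpret H: Hoeffding_ineq M "{..<n}" "\<lambda>i \<omega>. f (\<omega> i)" "\<lambda>_. lo" "\<lambda>_. hi" "real n * ?\<mu>"
      by unfold_locales (use indep AE_f in \<open>auto simp: expect\<close>)
    have "A e n = {\<omega>\<in>space M. n * e \<le> \<bar>(\<Sum>j<n. f (\<omega> j)) - n * ?\<mu>\<bar>}"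
    proof -
      have "e \<le> \<bar>S / n - ?\<mu>\<bar> \<longleftrightarrow> n * e \<le> \<bar>S - n * ?\<mu>\<bar>" for S
      proof -
        have "S - n * ?\<mu> = n * (S / n - ?\<mu>)" using that by (simp add: right_diff_distrib)
        then have "\<bar>S - n * ?\<mu>\<bar> = n * \<bar>S / n - ?\<mu>\<bar>" by (simp only: abs_mult abs_of_nat)
        then show ?thesis using that by simp
      qed
      then show ?thesis by (simp add: A_def)
    qed
    then have "measure M (A e n) \<le> 2 * exp (- 2 * (n * e)\<^sup>2 / (\<Sum>i<n. (hi - lo)\<^sup>2))"
      using H.Hoeffding_ineq_abs_ge[of "n * e"] that \<open>lo < hi\<close> by simp
    also have "- 2 * (n * e)\<^sup>2 / (\<Sum>i<n. (hi - lo)\<^sup>2) = real n * (- 2 * e\<^sup>2 / (hi - lo)\<^sup>2)"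
      using that by (simp add: power2_eq_square)
    finally show ?thesis by (simp only: exp_of_nat_mult)
  qed
  have "AE \<omega> in M. \<forall>\<^sub>F n in sequentially. \<omega> \<in> space M - A e n" if "0 < e" for e
  proof (rule borel_cantelli_AE1)
    have "summable (\<lambda>n. 2 * exp (- 2 * e\<^sup>2 / (hi - lo)\<^sup>2) ^ n)"
      using that \<open>lo < hi\<close> by (intro summable_mult summable_geometric) auto
    then show "summable (\<lambda>n. measure M (A e n))"
      by (rule summable_comparison_test_ev[rotated])
        (use A_bound[OF that] in \<open>auto intro!: eventually_mono[OF eventually_gt_at_top[of 0]]\<close>)
  qed (auto simp: MM.emeasure_eq_measure)
  then have "AE \<omega> in M. \<forall>m. \<forall>\<^sub>F n in sequentially. \<omega> \<in> space M - A (1 / real (Suc m)) n"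
    by (subst AE_all_countable) auto
  then have "AE \<omega> in M. (\<lambda>n. (\<Sum>j<n. f (\<omega> j)) / real n) \<longlonglongrightarrow> ?\<mu>"
  proof (rule eventually_mono)
    fix \<omega> assume *: "\<forall>m. \<forall>\<^sub>F n in sequentially. \<omega> \<in> space M - A (1 / real (Suc m)) n"
    show "(\<lambda>n. (\<Sum>j<n. f (\<omega> j)) / real n) \<longlonglongrightarrow> ?\<mu>"
    proof (rule tendstoI)
      fix e :: real assume "0 < e"
      then obtain m where m: "1 / real (Suc m) < e"
        using reals_Archimedean[of e] by (auto simp: inverse_eq_divide)
      show "\<forall>\<^sub>F n in sequentially. dist ((\<Sum>j<n. f (\<omega> j)) / real n) ?\<mu> < e"
        using *[rule_format, of m] by (rule eventually_mono) (use m in \<open>auto simp: A_def dist_real_def\<close>)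
    qed
  qed
  then show ?thesis by (simp only: M_def)
qed

context full_branch_system
begin

text \<open>Disjoint compact sets have positive distance. Infinitely many branches may accumulate, so
  finiteness matters here.\<close>

lemma finite_branches_separated:
  assumes "finite I"
  obtains \<delta> where "0 < \<delta>"
    "\<And>i j x y. i \<in> I \<Longrightarrow> j \<in> I \<Longrightarrow> i \<noteq> j \<Longrightarrow> x \<in> X i \<Longrightarrow> y \<in> X j \<Longrightarrow> \<delta> \<le> \<bar>x - y\<bar>"
proof -
  have "\<exists>d>0. \<forall>x\<in>X i. \<forall>y\<in>X j. d \<le> \<bar>x - y\<bar>" if "i \<noteq> j" for i j
    using separate_compact_closed[of "X i" "X j"] disjoint_branches[OF that]
    by (auto simp: X_def dist_real_def)
  then obtain d where d: "\<And>i j. i \<noteq> j \<Longrightarrow> 0 < d i j"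
    "\<And>i j x y. i \<noteq> j \<Longrightarrow> x \<in> X i \<Longrightarrow> y \<in> X j \<Longrightarrow> d i j \<le> \<bar>x - y\<bar>"
    by metis
  let ?D = "insert 1 ((\<lambda>(i, j). d i j) ` {(i, j) \<in> I \<times> I. i \<noteq> j})"
  have "finite {(i, j) \<in> I \<times> I. i \<noteq> j}"
    by (rule finite_subset[of _ "I \<times> I"]) (use assms in auto)
  then have fin: "finite ?D" by simp
  show ?thesis
  proof (rule that)
    show "0 < Min ?D" using fin d(1) by (subst Min_gr_iff) auto
    fix i j x y assume ij: "i \<in> I" "j \<in> I" "i \<noteq> j" "x \<in> X i" "y \<in> X j"
    then have "Min ?D \<le> d i j" using fin by (intro Min_le) auto
    with d(2)[of i j x y] ij show "Min ?D \<le> \<bar>x - y\<bar>" by linarith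
  qed
qed

text \<open>Blowing up the common cylinder of level \<open>m\<close> to unit length moves the two points into
  different branches.\<close>

lemma code_points_separated:
  assumes sep: "\<And>i j x y. i \<in> I \<Longrightarrow> j \<in> I \<Longrightarrow> i \<noteq> j \<Longrightarrow> x \<in> X i \<Longrightarrow> y \<in> X j \<Longrightarrow> \<delta> \<le> \<bar>x - y\<bar>"
    and agree: "\<And>j. j < m \<Longrightarrow> \<omega>' j = \<omega> j" and "\<omega> m \<in> I" "\<omega>' m \<in> I" "\<omega>' m \<noteq> \<omega> m"
  shows "\<delta> * scale m \<omega> \<le> \<bar>code_point \<omega> - code_point \<omega>'\<bar>"
proof -
  let ?s = "scale m \<omega>" and ?o = "offset m \<omega>"
  have s: "scale m \<omega>' = ?s" by (rule scale_cong) (rule agree)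
  have o: "offset m \<omega>' = ?o"
    unfolding offset_def by (intro sum.cong) (auto simp: agree intro!: scale_cong)
  have "(code_point \<omega> - ?o) / ?s \<in> X (\<omega> m)" "(code_point \<omega>' - ?o) / ?s \<in> X (\<omega>' m)"
    using code_point_in_cyl[of \<omega> "Suc m"] code_point_in_cyl[of \<omega>' "Suc m"] s o
    unfolding mem_cyl_Suc by auto
  from sep[OF _ _ _ this] assms(3-5)
  have "\<delta> \<le> \<bar>(code_point \<omega> - ?o) / ?s - (code_point \<omega>' - ?o) / ?s\<bar>" by auto
  also have "\<dots> = \<bar>code_point \<omega> - code_point \<omega>'\<bar> / ?s"
    using scale_pos[of m \<omega>] by (simp add: diff_divide_distrib[symmetric])
  finally show ?thesis using scale_pos[of m \<omega>] by (simp add: field_simps)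
qed

lemma scale_tendsto_0:
  assumes "finite I" "\<And>j. \<omega> j \<in> I"
  shows "(\<lambda>m. scale m \<omega>) \<longlonglongrightarrow> 0"
proof -
  let ?R = "Max (r ` I)"
  have "I \<noteq> {}" using assms(2) by blast
  then have R: "0 \<le> ?R" "?R < 1"
    using assms(1) r_less_1 r_pos by (auto simp: Max_ge_iff less_imp_le)
  have le: "scale m \<omega> \<le> ?R ^ m" for m
  proof -
    have "scale m \<omega> \<le> (\<Prod>j<m. ?R)"
      unfolding scale_def using assms r_pos by (intro prod_mono) (auto simp: less_imp_le)
    then show ?thesis by simp
  qed
  show ?thesis
    by (rule tendsto_sandwich[OF _ _ tendsto_const LIMSEQ_power_zero[of ?R]])
      (use R le scale_pos in \<open>auto simp: less_imp_le\<close>)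
qed

text \<open>The bound says that the level set has dimension at least entropy divided by exponent for every
  finitely supported Bernoulli measure with exponent \<open>\<alpha>\<close>. By the law of large
  numbers, almost every code satisfies
  \<open>weight m \<omega> \<le> scale m \<omega> powr s\<close> for all large \<open>m\<close>; so
  for some \<open>n\<close>, the set \<open>G n\<close> of typical codes for which this holds from
  level \<open>n\<close> on has positive measure. Given a cover, each of its sets \<open>U i\<close>
  is replaced by one cylinder set of codes (or the empty set) that contains all codes of
  \<open>G n\<close> coding points of \<open>U i\<close> and whose measure is at most a constant
  times \<open>diameter (U i) powr s\<close>, up to a small error. A cover with a small sum would
  therefore contradict the positive measure of \<open>G n\<close>.\<close>

lemma hausdorff_measure_level_ne_0:
  fixes p :: "nat pmf"
  assumes fin: "finite (set_pmf p)" and "0 < s"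
    and \<alpha>: "\<alpha> = measure_pmf.expectation p rate"
    and entropy: "s * \<alpha> < measure_pmf.expectation p (\<lambda>i. - ln (pmf p i))"
  shows "hausdorff_measure s (level \<alpha>) \<noteq> 0"
proof
  assume zero: "hausdorff_measure s (level \<alpha>) = 0"
  let ?N = "\<lambda>_::nat. measure_pmf p" and ?h = "\<lambda>i. - ln (pmf p i)" and ?I = "set_pmf p"
  define M where "M = PiM UNIV ?N"
  interpret product_prob_space ?N UNIV
    by (intro product_prob_spaceI) (rule measure_pmf.prob_space_axioms)
  interpret MM: prob_space M unfolding M_def by (rule P.prob_space_axioms)
  have space_M[simp]: "space M = UNIV" by (auto simp: M_def space_PiM PiE_def)
  have comp[measurable]: "(\<lambda>\<omega>. \<omega> i) \<in> measurable M (count_space UNIV)" for i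
    unfolding M_def by (rule measurable_compose[OF measurable_component_singleton]) auto

  have avg: "AE \<omega> in M. (\<lambda>n. (\<Sum>j<n. f (\<omega> j)) / real n) \<longlonglongrightarrow> measure_pmf.expectation p f"
    for f :: "nat \<Rightarrow> real"
    unfolding M_def
  proof (rule AE_average_tendsto_expectation)
    let ?B = "Max ((\<lambda>i. \<bar>f i\<bar>) ` ?I)"
    show "f i \<in> {- (\<bar>?B\<bar> + 1)..\<bar>?B\<bar> + 1}" if "i \<in> ?I" for i
    proof -
      have "\<bar>f i\<bar> \<le> ?B" using that fin by (intro Max_ge) auto
      then show ?thesis by auto
    qed
  qed auto
  have supp: "AE \<omega> in M. \<forall>j. \<omega> j \<in> ?I"
    unfolding AE_all_countable M_def
    by (intro allI AE_component) (auto simp: AE_measure_pmf_iff)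
  define Typ where "Typ \<omega> \<longleftrightarrow> (\<forall>j. \<omega> j \<in> ?I) \<and> (\<lambda>n. (\<Sum>j<n. rate (\<omega> j)) / real n) \<longlonglongrightarrow> \<alpha> \<and>
      (\<lambda>n. (\<Sum>j<n. ?h (\<omega> j)) / real n) \<longlonglongrightarrow> measure_pmf.expectation p ?h" for \<omega>
  from avg[of rate] avg[of ?h] supp have "AE \<omega> in M. Typ \<omega>"
    unfolding \<alpha> Typ_def by eventually_elim blast
  \<comment> \<open>All codes outside the null set \<open>Z\<close> are typical, which avoids measurability of the set of typical codes.\<close>
  then obtain Z where Z: "Z \<in> null_sets M" and "\<And>\<omega>. \<omega> \<notin> Z \<Longrightarrow> Typ \<omega>"
    by (auto simp: eventually_ae_filter)
  then have typical: "(\<forall>j. \<omega> j \<in> ?I) \<and> (\<lambda>n. (\<Sum>j<n. rate (\<omega> j)) / real n) \<longlonglongrightarrow> \<alpha> \<and>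
      (\<lambda>n. (\<Sum>j<n. ?h (\<omega> j)) / real n) \<longlonglongrightarrow> measure_pmf.expectation p ?h" if "\<omega> \<notin> Z" for \<omega>
    using that unfolding Typ_def by blast

  define weight where "weight m \<omega> = (\<Prod>j<m. pmf p (\<omega> j))" for m :: nat and \<omega>
  define G where "G n = {\<omega>. \<forall>m\<ge>n. weight m \<omega> \<le> scale m \<omega> powr s} - Z" for n
  have G_sets: "G n \<in> sets M" for n
  proof -
    have [measurable]: "weight m \<in> borel_measurable M" for m
      unfolding weight_def by (intro borel_measurable_prod measurable_compose[OF comp]) simp
    have [measurable]: "scale m \<in> borel_measurable M" for m
      unfolding scale_def by (intro borel_measurable_prod measurable_compose[OF comp]) simp
    have "{\<omega>\<in>space M. weight m \<omega> \<le> scale m \<omega> powr s} \<in> sets M" for m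
      by measurable
    then have "(\<Inter>m\<in>{n..}. {\<omega>. weight m \<omega> \<le> scale m \<omega> powr s}) \<in> sets M"
      by (intro sets.countable_INT') auto
    moreover have "(\<Inter>m\<in>{n..}. {\<omega>. weight m \<omega> \<le> scale m \<omega> powr s})
        = {\<omega>. \<forall>m\<ge>n. weight m \<omega> \<le> scale m \<omega> powr s}"
      by auto
    ultimately have "{\<omega>. \<forall>m\<ge>n. weight m \<omega> \<le> scale m \<omega> powr s} \<in> sets M" by simp
    then show ?thesis using Z by (auto simp: G_def)
  qed
  have G_cover: "\<exists>n. \<omega> \<in> G n" if "\<omega> \<notin> Z" for \<omega>
  proof -
    have I: "\<And>j. \<omega> j \<in> ?I"
      and rate: "(\<lambda>n. (\<Sum>j<n. rate (\<omega> j)) / real n) \<longlonglongrightarrow> \<alpha>"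
      and h: "(\<lambda>n. (\<Sum>j<n. ?h (\<omega> j)) / real n) \<longlonglongrightarrow> measure_pmf.expectation p ?h"
      using typical[OF that] by auto
    have "(\<lambda>n. (\<Sum>j<n. ?h (\<omega> j)) / real n - s * ((\<Sum>j<n. rate (\<omega> j)) / real n))
        \<longlonglongrightarrow> measure_pmf.expectation p ?h - s * \<alpha>"
      by (intro tendsto_intros rate h)
    from order_tendstoD(1)[OF this, of 0] entropy
    have "\<forall>\<^sub>F n in sequentially. 0 < (\<Sum>j<n. ?h (\<omega> j)) / real n - s * ((\<Sum>j<n. rate (\<omega> j)) / real n)"
      by simp
    then have "\<forall>\<^sub>F n in sequentially. weight n \<omega> \<le> scale n \<omega> powr s"
    proof (eventually_elim)
      case (elim n)
      then have "0 < n" by (cases n) auto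
      with elim have "s * (\<Sum>j<n. rate (\<omega> j)) \<le> (\<Sum>j<n. ?h (\<omega> j))"
        by (simp add: field_simps)
      moreover have "weight n \<omega> = exp (- (\<Sum>j<n. ?h (\<omega> j)))"
        unfolding weight_def using I by (simp add: sum_negf exp_sum pmf_positive)
      moreover have "scale n \<omega> powr s = exp (- (s * (\<Sum>j<n. rate (\<omega> j))))"
        by (simp add: scale_exp exp_powr_real mult.commute)
      ultimately show ?case by simp
    qed
    then show ?thesis using that by (auto simp: G_def eventually_sequentially)
  qed
  obtain n where n: "emeasure M (G n) \<noteq> 0"
  proof (rule ccontr)
    assume "\<not> thesis"
    then have "G n \<in> null_sets M" for n using that G_sets by (auto intro!: null_setsI)
    then have "(\<Union>n. G n) \<union> Z \<in> null_sets M" using Z by (intro null_sets.Un null_sets_UN) auto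
    moreover have "(\<Union>n. G n) \<union> Z = space M" using G_cover by auto
    ultimately show False using MM.emeasure_space_1 by (auto simp: null_sets_def)
  qed
  define g where "g = measure M (G n)"
  have g: "emeasure M (G n) = ennreal g" "0 < g"
    using n by (auto simp: g_def MM.emeasure_eq_measure zero_less_measure_iff)

  obtain \<delta> where \<delta>: "0 < \<delta>" and
    sep: "\<And>i j x y. i \<in> ?I \<Longrightarrow> j \<in> ?I \<Longrightarrow> i \<noteq> j \<Longrightarrow> x \<in> X i \<Longrightarrow> y \<in> X j \<Longrightarrow> \<delta> \<le> \<bar>x - y\<bar>"
    using finite_branches_separated[OF fin] by metis
  \<comment> \<open>A lower bound for the contraction, which turns small diameters into high levels.\<close>
  define \<rho> where "\<rho> = Min (r ` ?I)"
  have \<rho>: "0 < \<rho>" "\<rho> \<le> 1" "\<And>i. i \<in> ?I \<Longrightarrow> \<rho> \<le> r i"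
  proof -
    show "0 < \<rho>" unfolding \<rho>_def using fin r_pos set_pmf_not_empty[of p] by (subst Min_gr_iff) auto
    show le: "\<rho> \<le> r i" if "i \<in> ?I" for i unfolding \<rho>_def using fin that by (intro Min_le) auto
    obtain i where "i \<in> ?I" using set_pmf_not_empty[of p] by blast
    with le[of i] r_less_1[of i] show "\<rho> \<le> 1" by simp
  qed
  have scale_lower: "\<rho> ^ n \<le> scale m \<omega>" if "\<omega> \<in> G n" "m \<le> n" for \<omega> m
  proof -
    have "\<rho> ^ n \<le> (\<Prod>j<m. \<rho>)" using \<rho> that by (simp add: power_decreasing)
    also have "\<dots> \<le> scale m \<omega>"
      unfolding scale_def using typical[of \<omega>] that \<rho> by (intro prod_mono) (auto simp: G_def less_imp_le)
    finally show ?thesis .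
  qed

  have "0 < ennreal (\<delta> powr s * (g / 2))" "0 < \<delta> * \<rho> ^ n / 2" using \<delta> g \<rho> by simp_all
  then obtain U where U: "hausdorff_cover (\<delta> * \<rho> ^ n / 2) (level \<alpha>) U"
    and U_sum: "(\<Sum>i. ennreal (diameter (U i) powr s)) < ennreal (\<delta> powr s * (g / 2))"
    using hausdorff_measure_eq_0_D[OF zero] by metis

  define Cyl where "Cyl m \<omega> = {\<omega>'. \<forall>j\<in>{..<m}. \<omega>' j \<in> {\<omega> j}}" for m and \<omega> :: "nat \<Rightarrow> nat"
  have Cyl_sets: "Cyl m \<omega> \<in> sets M" for m \<omega>
  proof -
    have "{\<omega>'\<in>space M. \<omega>' j \<in> {\<omega> j}} \<in> sets M" for j
      using measurable_sets[OF comp, of "{\<omega> j}" j] by (simp add: vimage_def)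
    then have "{\<omega>'\<in>space M. \<forall>j\<in>{..<m}. \<omega>' j \<in> {\<omega> j}} \<in> sets M"
      by (intro sets.sets_Collect_finite_All) auto
    then show ?thesis by (simp add: Cyl_def)
  qed
  have Cyl_measure: "emeasure M (Cyl m \<omega>) = ennreal (weight m \<omega>)" for m \<omega>
    using emeasure_PiM_Collect[of "{..<m}" "\<lambda>j. {\<omega> j}"] space_M
    unfolding M_def[symmetric] Cyl_def weight_def
    by (simp add: emeasure_pmf_single prod_ennreal)

  have "\<exists>D\<in>sets M. {\<omega>\<in>G n. code_point \<omega> \<in> U i} \<subseteq> D \<and>
      emeasure M D \<le> ennreal (\<delta> powr (- s)) * ennreal (diameter (U i) powr s) + ennreal e"
    if "0 < e" for i e
  proof (cases "\<exists>\<omega>\<in>G n. code_point \<omega> \<in> U i")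
    case False
    then show ?thesis by (intro bexI[of _ "{}"]) auto
  next
    case True
    then obtain \<omega> where \<omega>: "\<omega> \<in> G n" "code_point \<omega> \<in> U i" by blast
    have \<omega>I: "\<omega>' j \<in> ?I" if "\<omega>' \<in> G n" for \<omega>' j using typical[of \<omega>'] that by (auto simp: G_def)
    have weight_le: "weight m \<omega> \<le> scale m \<omega> powr s" if "n \<le> m" for m
      using \<omega>(1) that by (simp add: G_def)
    show ?thesis
    proof (cases "\<exists>\<omega>'\<in>G n. code_point \<omega>' \<in> U i \<and> \<omega>' \<noteq> \<omega>")
      case False
      \<comment> \<open>Only one code is left: \<open>U i\<close> may have diameter zero, so a cylinder of small measure is taken instead.\<close>
      have "(\<lambda>m. scale m \<omega> powr s) \<longlonglongrightarrow> 0"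
        by (rule tendsto_zero_powrI[OF scale_tendsto_0[OF fin, of \<omega>] tendsto_const])
          (use \<open>0 < s\<close> \<omega>I[OF \<omega>(1)] in \<open>auto simp: scale_pos less_imp_le\<close>)
      then have "\<forall>\<^sub>F m in sequentially. scale m \<omega> powr s < e"
        using \<open>0 < e\<close> by (rule order_tendstoD)
      then have "\<forall>\<^sub>F m in sequentially. scale m \<omega> powr s < e \<and> n \<le> m"
        by (intro eventually_conj eventually_ge_at_top)
      from eventually_happens[OF this] obtain m where m: "scale m \<omega> powr s < e" "n \<le> m" by auto
      have "emeasure M (Cyl m \<omega>) \<le> ennreal e"
        unfolding Cyl_measure using weight_le[OF m(2)] m(1) by (intro ennreal_leI) simp
      then have "emeasure M (Cyl m \<omega>) \<le> ennreal (\<delta> powr (- s)) * ennreal (diameter (U i) powr s) + ennreal e"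
        by (rule order_trans) simp
      then show ?thesis
        using False by (intro bexI[of _ "Cyl m \<omega>"] conjI Cyl_sets) (auto simp: Cyl_def)
    next
      case True
      \<comment> \<open>Let \<open>m\<close> be the first place where two of the codes differ; then \<open>diameter (U i)\<close> is at least of order \<open>scale m \<omega>\<close>.\<close>
      define differ where "differ m \<longleftrightarrow> (\<exists>\<omega>'\<in>G n. code_point \<omega>' \<in> U i \<and> \<omega>' m \<noteq> \<omega> m)" for m
      have "\<exists>m. differ m" using True unfolding differ_def by (metis ext)
      define m where "m = (LEAST m. differ m)"
      have "differ m" unfolding m_def by (rule LeastI_ex) fact
      then obtain \<omega>' where \<omega>': "\<omega>' \<in> G n" "code_point \<omega>' \<in> U i" "\<omega>' m \<noteq> \<omega> m"
        by (auto simp: differ_def)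
      have agree: "\<omega>'' j = \<omega> j" if "\<omega>'' \<in> G n" "code_point \<omega>'' \<in> U i" "j < m" for \<omega>'' j
      proof -
        have "\<not> differ j" using that(3) unfolding m_def by (rule not_less_Least)
        then show ?thesis using that by (auto simp: differ_def)
      qed
      have "\<delta> * scale m \<omega> \<le> \<bar>code_point \<omega> - code_point \<omega>'\<bar>"
        by (rule code_points_separated[OF sep]) (use agree \<omega>' \<omega> \<omega>I in auto)
      also have "\<dots> \<le> diameter (U i)"
        using diameter_bounded_bound[of "U i" "code_point \<omega>" "code_point \<omega>'"] U \<omega>(2) \<omega>'(2)
        by (auto simp: hausdorff_cover_def dist_real_def)
      finally have diam: "\<delta> * scale m \<omega> \<le> diameter (U i)" .
      also have "\<dots> < \<delta> * \<rho> ^ n"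
      proof -
        have "diameter (U i) \<le> \<delta> * \<rho> ^ n / 2" using U by (auto simp: hausdorff_cover_def)
        also have "\<dots> < \<delta> * \<rho> ^ n" using \<delta> \<rho> by simp
        finally show ?thesis .
      qed
      finally have "scale m \<omega> < \<rho> ^ n" using \<delta> by simp
      then have "n \<le> m" using scale_lower[OF \<omega>(1), of m] by linarith
      have "scale m \<omega> powr s \<le> (diameter (U i) / \<delta>) powr s"
        using diam \<delta> scale_pos[of m \<omega>] \<open>0 < s\<close> by (intro powr_mono2) (auto simp: field_simps)
      also have "\<dots> = \<delta> powr (- s) * diameter (U i) powr s"
        using \<delta> diam scale_pos[of m \<omega>] by (simp add: powr_divide powr_minus field_simps)
      finally have "weight m \<omega> \<le> \<delta> powr (- s) * diameter (U i) powr s"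
        using weight_le[OF \<open>n \<le> m\<close>] by simp
      then have "emeasure M (Cyl m \<omega>) \<le> ennreal (\<delta> powr (- s)) * ennreal (diameter (U i) powr s) + 0"
        unfolding Cyl_measure by (auto simp: ennreal_mult[symmetric] intro: ennreal_leI)
      then have "emeasure M (Cyl m \<omega>) \<le> ennreal (\<delta> powr (- s)) * ennreal (diameter (U i) powr s) + ennreal e"
        by (rule order_trans) (intro add_left_mono, simp)
      moreover have "{\<omega>\<in>G n. code_point \<omega> \<in> U i} \<subseteq> Cyl m \<omega>"
        using agree by (auto simp: Cyl_def)
      ultimately show ?thesis using Cyl_sets by blast
    qed
  qed
  then have "\<forall>i. \<exists>D\<in>sets M. {\<omega>\<in>G n. code_point \<omega> \<in> U i} \<subseteq> D \<and>
      emeasure M D \<le> ennreal (\<delta> powr (- s)) * ennreal (diameter (U i) powr s) + ennreal (g / 2 * (1 / 2) ^ Suc i)"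
    using g by simp
  from choice[OF this[unfolded Bex_def]]
  obtain D where D: "\<And>i. D i \<in> sets M" "\<And>i. {\<omega>\<in>G n. code_point \<omega> \<in> U i} \<subseteq> D i"
    "\<And>i. emeasure M (D i) \<le> ennreal (\<delta> powr (- s)) * ennreal (diameter (U i) powr s) + ennreal (g / 2 * (1 / 2) ^ Suc i)"
    by blast
  have "G n \<subseteq> (\<Union>i. D i)"
  proof
    fix \<omega> assume \<omega>: "\<omega> \<in> G n"
    then have "code_point \<omega> \<in> level \<alpha>"
      using typical[of \<omega>] by (intro code_point_in_level) (auto simp: G_def)
    then obtain i where "code_point \<omega> \<in> U i" using U by (auto simp: hausdorff_cover_def)
    with D(2)[of i] \<omega> show "\<omega> \<in> (\<Union>i. D i)" by blast
  qed
  then have "ennreal g \<le> emeasure M (\<Union>i. D i)"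
    unfolding g(1)[symmetric] using D(1) by (intro emeasure_mono) auto
  also have "\<dots> \<le> (\<Sum>i. emeasure M (D i))"
    using D(1) by (intro emeasure_subadditive_countably) auto
  also have "\<dots> \<le> (\<Sum>i. ennreal (\<delta> powr (- s)) * ennreal (diameter (U i) powr s) + ennreal (g / 2 * (1 / 2) ^ Suc i))"
    by (intro suminf_le D) auto
  also have "\<dots> = ennreal (\<delta> powr (- s)) * (\<Sum>i. ennreal (diameter (U i) powr s)) + (\<Sum>i. ennreal (g / 2 * (1 / 2) ^ Suc i))"
    by (simp add: suminf_add[symmetric])
  also have "(\<Sum>i. ennreal (g / 2 * (1 / 2) ^ Suc i)) = ennreal (g / 2)"
  proof -
    have "(\<lambda>i. g / 2 * (1 / 2) ^ Suc i) sums (g / 2 * 1)"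
      by (intro sums_mult power_half_series)
    then show ?thesis using g by (intro suminf_ennreal_eq) auto
  qed
  also have "ennreal (\<delta> powr (- s)) * (\<Sum>i. ennreal (diameter (U i) powr s)) + ennreal (g / 2) < ennreal g"
  proof -
    have "ennreal (\<delta> powr (- s)) * (\<Sum>i. ennreal (diameter (U i) powr s))
        < ennreal (\<delta> powr (- s)) * ennreal (\<delta> powr s * (g / 2))"
      using U_sum \<delta> by (intro ennreal_mult_strict_left_mono) auto
    also have "\<dots> = ennreal (g / 2)"
      using \<delta> g by (simp add: ennreal_mult[symmetric] powr_minus)
    finally have "ennreal (\<delta> powr (- s)) * (\<Sum>i. ennreal (diameter (U i) powr s)) + ennreal (g / 2) < ennreal (g / 2) + ennreal (g / 2)"
      by (simp add: ennreal_add_left_cancel_less add.commute)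
    also have "\<dots> = ennreal g" using g by (simp flip: ennreal_plus)
    finally show ?thesis .
  qed
  finally show False by simp
qed

end

section \<open>Repeated differentiability on open sets\<close>

text \<open>Each derivative is required to exist on all of \<open>S\<close>. For open \<open>S\<close> this implies the pointwise
  notion \<open>times_differentiable_at\<close>, and closure under sums, products, inverses and compositions
  follows by a plain induction on the order.\<close>

fun times_differentiable_on :: "nat \<Rightarrow> real set \<Rightarrow> (real \<Rightarrow> real) \<Rightarrow> bool" where
  "times_differentiable_on 0 S f \<longleftrightarrow> True"
| "times_differentiable_on (Suc n) S f \<longleftrightarrow>
     (\<exists>f'. (\<forall>x\<in>S. (f has_real_derivative f' x) (at x)) \<and> times_differentiable_on n S f')"

lemma times_differentiable_on_SucI:
  "(\<And>x. x \<in> S \<Longrightarrow> (f has_real_derivative f' x) (at x)) \<Longrightarrow> times_differentiable_on n S f' \<Longrightarrow> times_differentiable_on (Suc n) S f"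
  by auto

lemma times_differentiable_on_lower: "times_differentiable_on (Suc n) S f \<Longrightarrow> times_differentiable_on n S f"
  by (induction n arbitrary: f) auto

lemma times_differentiable_on_cong:
  assumes "open S" "\<And>x. x \<in> S \<Longrightarrow> f x = g x" "times_differentiable_on n S f"
  shows "times_differentiable_on n S g"
proof (cases n)
  case (Suc m)
  with assms(3) obtain f' where f': "\<And>x. x \<in> S \<Longrightarrow> (f has_real_derivative f' x) (at x)" "times_differentiable_on m S f'"
    by auto
  have "(g has_real_derivative f' x) (at x)" if "x \<in> S" for x
    using f'(1)[OF that] \<open>open S\<close> that by (rule has_field_derivative_transform_within_open) (rule assms(2))
  with f'(2) Suc show ?thesis by auto
qed simp

lemma times_differentiable_on_const: "times_differentiable_on n S (\<lambda>_. c)"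
  by (induction n arbitrary: c) (auto intro!: exI[of _ "\<lambda>_. 0"])

lemma times_differentiable_on_id: "times_differentiable_on n S (\<lambda>x. x)"
  by (cases n) (auto intro!: exI[of _ "\<lambda>_. 1"] times_differentiable_on_const)

lemma times_differentiable_on_add: "times_differentiable_on n S f \<Longrightarrow> times_differentiable_on n S g \<Longrightarrow> times_differentiable_on n S (\<lambda>x. f x + g x)"
proof (induction n arbitrary: f g)
  case (Suc n)
  then obtain f' g' where "\<forall>x\<in>S. (f has_real_derivative f' x) (at x)" "times_differentiable_on n S f'"
    "\<forall>x\<in>S. (g has_real_derivative g' x) (at x)" "times_differentiable_on n S g'" by auto
  then show ?case
    by (intro times_differentiable_on_SucI[of _ _ "\<lambda>x. f' x + g' x"] Suc.IH) (auto intro!: derivative_intros)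
qed simp

lemma times_differentiable_on_mult: "times_differentiable_on n S f \<Longrightarrow> times_differentiable_on n S g \<Longrightarrow> times_differentiable_on n S (\<lambda>x. f x * g x)"
proof (induction n arbitrary: f g)
  case (Suc n)
  then obtain f' g' where *: "\<forall>x\<in>S. (f has_real_derivative f' x) (at x)" "times_differentiable_on n S f'"
    "\<forall>x\<in>S. (g has_real_derivative g' x) (at x)" "times_differentiable_on n S g'" by auto
  have "times_differentiable_on n S f" "times_differentiable_on n S g" using Suc.prems by (simp_all only: times_differentiable_on_lower)
  with * show ?case
    by (intro times_differentiable_on_SucI[of _ _ "\<lambda>x. f x * g' x + f' x * g x"] times_differentiable_on_add Suc.IH)
      (auto intro!: derivative_eq_intros)
qed simp

lemma times_differentiable_on_uminus: "times_differentiable_on n S f \<Longrightarrow> times_differentiable_on n S (\<lambda>x. - f x)"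
  using times_differentiable_on_mult[OF times_differentiable_on_const[of n S "-1"]] by auto

lemma times_differentiable_on_inverse: "(\<And>x. x \<in> S \<Longrightarrow> f x \<noteq> 0) \<Longrightarrow> times_differentiable_on n S f \<Longrightarrow> times_differentiable_on n S (\<lambda>x. inverse (f x))"
proof (induction n arbitrary: f)
  case (Suc n)
  then obtain f' where *: "\<forall>x\<in>S. (f has_real_derivative f' x) (at x)" "times_differentiable_on n S f'" by auto
  have "times_differentiable_on n S f" by (rule times_differentiable_on_lower) fact
  then have "times_differentiable_on n S (\<lambda>x. inverse (f x))" by (intro Suc.IH Suc.prems)
  with * Suc.prems(1) show ?case
    by (intro times_differentiable_on_SucI[of _ _ "\<lambda>x. - (inverse (f x) * f' x * inverse (f x))"] times_differentiable_on_uminus times_differentiable_on_mult)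
      (auto intro!: derivative_eq_intros)
qed simp

lemma times_differentiable_on_compose:
  "times_differentiable_on n R f \<Longrightarrow> times_differentiable_on n S g \<Longrightarrow> (\<And>x. x \<in> S \<Longrightarrow> g x \<in> R) \<Longrightarrow> times_differentiable_on n S (\<lambda>x. f (g x))"
proof (induction n arbitrary: f)
  case (Suc n)
  then obtain f' g' where *: "\<forall>x\<in>R. (f has_real_derivative f' x) (at x)" "times_differentiable_on n R f'"
    "\<forall>x\<in>S. (g has_real_derivative g' x) (at x)" "times_differentiable_on n S g'" by auto
  have "times_differentiable_on n S g" by (rule times_differentiable_on_lower) fact
  then have "times_differentiable_on n S (\<lambda>x. f' (g x))" by (rule Suc.IH[OF *(2)]) (rule Suc.prems(3))
  with * have "times_differentiable_on n S (\<lambda>x. f' (g x) * g' x)" by (intro times_differentiable_on_mult) auto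
  moreover have "((\<lambda>x. f (g x)) has_real_derivative f' (g x) * g' x) (at x)" if "x \<in> S" for x
    using * Suc.prems(3) that by (intro DERIV_chain2) auto
  ultimately show ?case by (intro times_differentiable_on_SucI[where f' = "\<lambda>x. f' (g x) * g' x"])
qed simp

lemma times_differentiable_on_deriv:
  assumes "open S" "times_differentiable_on (Suc n) S f"
  shows "times_differentiable_on n S (deriv f)"
proof -
  from assms(2) obtain f' where f': "\<And>x. x \<in> S \<Longrightarrow> (f has_real_derivative f' x) (at x)" "times_differentiable_on n S f'"
    by auto
  show ?thesis
    by (rule times_differentiable_on_cong[OF assms(1) _ f'(2)]) (use f'(1) DERIV_imp_deriv in force)
qed

lemma times_differentiable_on_funpow_deriv:
  assumes "open S" "times_differentiable_on (n + m) S f"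
  shows "times_differentiable_on m S ((deriv ^^ n) f)"
  using assms(2)
proof (induction n arbitrary: m)
  case (Suc n)
  from Suc.IH[of "Suc m"] Suc.prems have "times_differentiable_on (Suc m) S ((deriv ^^ n) f)" by simp
  from times_differentiable_on_deriv[OF assms(1) this] show ?case by simp
qed simp

lemma smooth_funpow_deriv_differentiable:
  assumes "open S" "\<And>n. times_differentiable_on n S f" "x \<in> S"
  shows "((deriv ^^ n) f has_real_derivative (deriv ^^ Suc n) f x) (at x)"
proof -
  have "times_differentiable_on 1 S ((deriv ^^ n) f)" by (rule times_differentiable_on_funpow_deriv) (use assms in auto)
  then obtain f' where "((deriv ^^ n) f has_real_derivative f' x) (at x)" using assms(3) by auto
  then show ?thesis by (simp add: DERIV_imp_deriv)
qed

lemma smooth_times_differentiable_at: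
  assumes "open S" "\<And>n. times_differentiable_on n S f" "x \<in> S"
  shows "times_differentiable_at n f x"
  using assms(3)
proof (induction n arbitrary: x)
  case (Suc n)
  have "\<forall>\<^sub>F y in nhds x. times_differentiable_at n f y"
    using assms(1) Suc by (auto simp: eventually_nhds)
  moreover have "(deriv ^^ n) f field_differentiable (at x)"
    using smooth_funpow_deriv_differentiable[OF assms(1,2) Suc.prems]
    by (auto simp: field_differentiable_def)
  ultimately show ?case by simp
qed simp

lemma power_le_fact_exp:
  fixes x :: real
  assumes "0 \<le> x"
  shows "x ^ k \<le> fact k * exp x"
proof -
  have "(\<Sum>n\<in>{k}. x ^ n /\<^sub>R fact n) \<le> (\<Sum>n. x ^ n /\<^sub>R fact n)"
    using summable_exp_generic[of x] assms by (intro sum_le_suminf) auto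
  then show ?thesis by (simp add: exp_def field_simps)
qed

section \<open>The pressure of a system with finite partition sums\<close>

locale entire_pressure_system = full_branch_system +
  assumes summable_r_powr: "0 < t \<Longrightarrow> summable (\<lambda>i. r i powr t)"
begin

text \<open>Up to sign, the \<open>k\<close>-th derivative of the partition sum \<open>\<Sum>i. r i powr t\<close>.\<close>

definition moment :: "nat \<Rightarrow> real \<Rightarrow> real" where
  "moment k t = (\<Sum>i. rate i ^ k * exp (- t * rate i))"

lemma r_powr: "r i powr t = exp (- t * rate i)"
  using r_pos[of i] by (simp add: powr_def rate_def)

text \<open>Half of the exponential decay absorbs the polynomial factor.\<close>

lemma moment_term_le:
  assumes "0 < t"
  shows "rate i ^ k * exp (- t * rate i) \<le> fact k * (2 / t) ^ k * r i powr (t / 2)"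
proof -
  have "(t / 2 * rate i) ^ k \<le> fact k * exp (t / 2 * rate i)"
    using assms rate_pos[of i] by (intro power_le_fact_exp) auto
  then have "(2 / t) ^ k * (t / 2 * rate i) ^ k * exp (- t * rate i)
      \<le> (2 / t) ^ k * (fact k * exp (t / 2 * rate i)) * exp (- t * rate i)"
    using assms by (intro mult_right_mono mult_left_mono) auto
  also have "(2 / t) ^ k * (t / 2 * rate i) ^ k = rate i ^ k"
    using assms by (simp flip: power_mult_distrib)
  also have "(2 / t) ^ k * (fact k * exp (t / 2 * rate i)) * exp (- t * rate i)
      = fact k * (2 / t) ^ k * r i powr (t / 2)"
    by (simp add: r_powr mult_exp_exp field_simps)
  finally show ?thesis .
qed

lemma summable_moment:
  assumes "0 < t"
  shows "summable (\<lambda>i. rate i ^ k * exp (- t * rate i))"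
proof (rule summable_comparison_test)
  show "summable (\<lambda>i. fact k * (2 / t) ^ k * r i powr (t / 2))"
    using assms by (intro summable_mult summable_r_powr) simp
  show "\<exists>N. \<forall>i\<ge>N. norm (rate i ^ k * exp (- t * rate i)) \<le> fact k * (2 / t) ^ k * r i powr (t / 2)"
    using moment_term_le[OF assms] rate_pos by (auto simp: abs_mult less_imp_le)
qed

lemma moment_has_derivative:
  assumes "0 < t"
  shows "(moment k has_real_derivative - moment (Suc k) t) (at t)"
proof -
  let ?f = "\<lambda>i x. rate i ^ k * exp (- x * rate i)"
  let ?f' = "\<lambda>i x. - (rate i ^ Suc k * exp (- x * rate i))"
  have "((\<lambda>x. \<Sum>i. ?f i x) has_real_derivative (\<Sum>i. ?f' i t)) (at t)"
  proof (rule has_field_derivative_series'(2))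
    show "convex {t / 2..}" by simp
    show "(?f i has_real_derivative ?f' i x) (at x within {t / 2..})" for i x
      by (auto intro!: derivative_eq_intros)
    show "uniformly_convergent_on {t / 2..} (\<lambda>n x. \<Sum>i<n. ?f' i x)"
    proof (rule Weierstrass_m_test')
      show "norm (?f' i x) \<le> rate i ^ Suc k * exp (- (t / 2) * rate i)" if "x \<in> {t / 2..}" for i x
        using that rate_pos[of i] by (auto simp: abs_mult intro!: mult_left_mono mult_right_mono)
      show "summable (\<lambda>i. rate i ^ Suc k * exp (- (t / 2) * rate i))"
        using assms by (intro summable_moment) simp
    qed
    show "t \<in> {t / 2..}" "t \<in> interior {t / 2..}" using assms by (auto simp: interior_real_atLeast)
    show "summable (\<lambda>i. ?f i t)" by (rule summable_moment[OF assms])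
  qed
  also have "(\<Sum>i. ?f' i t) = - moment (Suc k) t"
    unfolding moment_def by (intro suminf_minus summable_moment assms)
  finally show ?thesis by (simp add: moment_def[abs_def])
qed

lemma moment_pos: "0 < t \<Longrightarrow> 0 < moment k t"
  unfolding moment_def using rate_pos by (intro suminf_pos summable_moment) auto

lemma times_differentiable_on_moment: "times_differentiable_on n {0<..} (moment k)"
proof (induction n arbitrary: k)
  case (Suc n)
  then show ?case
    by (intro times_differentiable_on_SucI[of _ _ "\<lambda>t. - moment (Suc k) t"] times_differentiable_on_uminus)
      (auto intro!: moment_has_derivative)
qed simp

definition pressure :: "real \<Rightarrow> real" where
  "pressure t = ln (moment 0 t)"

text \<open>Mean and variance of \<open>rate\<close> under the Gibbs weights \<open>r i powr t / moment 0 t\<close>. They are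
  the first derivative of the pressure up to sign and its second derivative.\<close>

definition mean :: "real \<Rightarrow> real" where
  "mean t = moment 1 t / moment 0 t"

definition variance :: "real \<Rightarrow> real" where
  "variance t = moment 2 t / moment 0 t - (mean t)\<^sup>2"

lemma pressure_has_derivative: "0 < t \<Longrightarrow> (pressure has_real_derivative - mean t) (at t)"
  unfolding pressure_def[abs_def] mean_def using moment_pos[of t 0]
  by (auto intro!: derivative_eq_intros moment_has_derivative simp: field_simps)

lemma mean_has_derivative: "0 < t \<Longrightarrow> (mean has_real_derivative - variance t) (at t)"
  unfolding mean_def[abs_def] variance_def using moment_pos[of t 0]
  by (auto intro!: derivative_eq_intros moment_has_derivative
      simp: field_simps power2_eq_square numeral_2_eq_2)

lemma mean_pos: "0 < t \<Longrightarrow> 0 < mean t"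
  using moment_pos by (simp add: mean_def)

text \<open>Constant lengths would make the partition sum infinite.\<close>

lemma rates_not_constant: "\<exists>i. rate i \<noteq> c"
proof (rule ccontr)
  assume "\<not> ?thesis"
  then have "(\<lambda>i. r i powr 1) = (\<lambda>_. exp (- c))"
    unfolding r_powr by auto
  then have "summable (\<lambda>_::nat. exp (- c))" using summable_r_powr[of 1] by simp
  then show False by (simp add: summable_const_iff)
qed

text \<open>Multiplied by \<open>moment 0 t\<close>, the variance is a series of weighted squared deviations, one of
  which is nonzero.\<close>

lemma variance_pos:
  assumes "0 < t"
  shows "0 < variance t"
proof -
  let ?m = "mean t" and ?e = "\<lambda>i. exp (- t * rate i)"
  have s: "(\<lambda>i. rate i ^ k * ?e i) sums moment k t" for k
    unfolding moment_def by (intro summable_sums summable_moment assms)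
  have "(\<lambda>i. rate i ^ 2 * ?e i - 2 * ?m * (rate i ^ 1 * ?e i) + ?m\<^sup>2 * (rate i ^ 0 * ?e i)) sums
      (moment 2 t - 2 * ?m * moment 1 t + ?m\<^sup>2 * moment 0 t)"
    by (intro sums_add sums_diff sums_mult s)
  moreover have "(\<lambda>i. rate i ^ 2 * ?e i - 2 * ?m * (rate i ^ 1 * ?e i) + ?m\<^sup>2 * (rate i ^ 0 * ?e i))
      = (\<lambda>i. (rate i - ?m)\<^sup>2 * ?e i)"
    by (simp add: fun_eq_iff power2_eq_square algebra_simps)
  moreover have "moment 2 t - 2 * ?m * moment 1 t + ?m\<^sup>2 * moment 0 t = variance t * moment 0 t"
    using moment_pos[OF assms, of 0] by (simp add: variance_def mean_def power2_eq_square field_simps)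
  ultimately have sums: "(\<lambda>i. (rate i - ?m)\<^sup>2 * ?e i) sums (variance t * moment 0 t)" by simp
  obtain j where "rate j \<noteq> ?m" using rates_not_constant by blast
  then have "0 < (\<Sum>i. (rate i - ?m)\<^sup>2 * ?e i)"
    by (intro suminf_pos2[of _ j]) (use sums in \<open>auto simp: sums_iff\<close>)
  then show ?thesis using sums moment_pos[OF assms, of 0] by (simp add: sums_iff zero_less_mult_iff)
qed

lemma mean_strict_antimono: "0 < s \<Longrightarrow> s < t \<Longrightarrow> mean t < mean s"
  by (rule DERIV_neg_imp_decreasing)
    (auto intro!: exI[of _ "- variance x" for x] mean_has_derivative variance_pos)

lemma pressure_strict_antimono: "0 < s \<Longrightarrow> s < t \<Longrightarrow> pressure t < pressure s"
  by (rule DERIV_neg_imp_decreasing)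
    (auto intro!: exI[of _ "- mean x" for x] pressure_has_derivative mean_pos)

text \<open>As \<open>t\<close> tends to \<open>0\<close>, each term \<open>r i powr t\<close> tends to \<open>1\<close>.\<close>

lemma pressure_unbounded_at_0: "\<exists>t0>0. \<forall>t\<in>{0<..t0}. C < pressure t"
proof -
  obtain N where N: "exp C < real N" using reals_Archimedean2 by blast
  have "((\<lambda>t. \<Sum>i<N. exp (- t * rate i)) \<longlongrightarrow> (\<Sum>i<N. exp (- 0 * rate i))) (at_right 0)"
    by (intro tendsto_intros)
  then have "\<forall>\<^sub>F t in at_right 0. exp C < (\<Sum>i<N. exp (- t * rate i))"
    using N by (intro order_tendstoD(1)) auto
  then obtain b where b: "0 < b" "\<And>t. 0 < t \<Longrightarrow> t < b \<Longrightarrow> exp C < (\<Sum>i<N. exp (- t * rate i))"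
    by (auto simp: eventually_at_right_field)
  have "C < pressure t" if "t \<in> {0<..b / 2}" for t
  proof -
    have "exp C < (\<Sum>i<N. exp (- t * rate i))" using b that by auto
    also have "\<dots> \<le> moment 0 t"
      using summable_moment[of t 0] that unfolding moment_def by (auto intro!: sum_le_suminf)
    finally have "ln (exp C) < ln (moment 0 t)"
      using moment_pos[of t 0] that by (subst ln_less_cancel_iff) auto
    then show ?thesis by (simp add: pressure_def)
  qed
  then show ?thesis using \<open>0 < b\<close> by (intro exI[of _ "b / 2"]) auto
qed

text \<open>A function with bounded slope could not tend to infinity at \<open>0\<close>.\<close>

lemma mean_unbounded_at_0:
  assumes "0 < t0"
  shows "\<exists>t. 0 < t \<and> t < t0 \<and> C < mean t"
proof (rule ccontr)
  assume contra: "\<not> ?thesis"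
  obtain t1 where t1: "0 < t1" "\<And>t. t \<in> {0<..t1} \<Longrightarrow> pressure t0 + \<bar>C\<bar> * t0 < pressure t"
    using pressure_unbounded_at_0 by blast
  define t where "t = min t1 (t0 / 2)"
  have t: "0 < t" "t < t0" "t \<le> t1" using assms t1 by (auto simp: t_def)
  obtain z where z: "t < z" "z < t0" "pressure t0 - pressure t = (t0 - t) * (- mean z)"
    using MVT2[OF t(2), of pressure "\<lambda>t. - mean t"] pressure_has_derivative t by force
  have "\<not> C < mean z" using contra less_trans[OF t(1) z(1)] z(2) by blast
  then have "mean z \<le> \<bar>C\<bar>" by linarith
  then have "(t0 - t) * mean z \<le> t0 * \<bar>C\<bar>" using z t mean_pos[of z] by (intro mult_mono) auto
  then show False using t1(2)[of t] t z by (simp add: mult.commute)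
qed

lemma times_differentiable_on_pressure: "times_differentiable_on n {0<..} pressure"
proof (cases n)
  case (Suc m)
  have "times_differentiable_on m {0<..} (\<lambda>t. - (moment 1 t * inverse (moment 0 t)))"
    using moment_pos[of _ 0]
    by (intro times_differentiable_on_uminus times_differentiable_on_mult times_differentiable_on_inverse times_differentiable_on_moment) (force dest: less_imp_neq)
  then have "times_differentiable_on m {0<..} (\<lambda>t. - mean t)" unfolding mean_def divide_inverse .
  then show ?thesis unfolding Suc
    by (rule times_differentiable_on_SucI[rotated]) (simp add: pressure_has_derivative)
qed simp

lemma times_differentiable_on_variance: "times_differentiable_on n {0<..} variance"
proof -
  have nz: "moment 0 t \<noteq> 0" if "t \<in> {0<..}" for t using moment_pos[of t 0] that by auto
  have "times_differentiable_on n {0<..} (\<lambda>t. moment 2 t * inverse (moment 0 t)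
      + - ((moment 1 t * inverse (moment 0 t)) * (moment 1 t * inverse (moment 0 t))))"
    by (intro times_differentiable_on_add times_differentiable_on_uminus times_differentiable_on_mult times_differentiable_on_inverse times_differentiable_on_moment nz)
  then show ?thesis
    by (simp add: variance_def[abs_def] mean_def[abs_def] divide_inverse power2_eq_square)
qed

end

section \<open>The spectrum as a Legendre transform of the pressure\<close>

lemma exists_pmf_weights:
  fixes w :: "nat \<Rightarrow> real"
  assumes "\<And>i. i < N \<Longrightarrow> 0 \<le> w i" "(\<Sum>i<N. w i) = 1"
  obtains p where "pmf p = (\<lambda>i. if i < N then w i else 0)"
proof -
  let ?w = "\<lambda>i. if i < N then w i else 0"
  have nonneg: "0 \<le> ?w i" for i using assms(1) by auto
  have "(\<integral>\<^sup>+ i. ennreal (?w i) \<partial>count_space UNIV) = (\<Sum>i<N. ennreal (?w i))"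
    by (rule nn_integral_count_space') auto
  also have "\<dots> = ennreal (\<Sum>i<N. ?w i)" using nonneg by (rule sum_ennreal)
  also have "\<dots> = 1" using assms(2) by simp
  finally have "pmf (embed_pmf ?w) i = ?w i" for i using nonneg by (intro pmf_embed_pmf)
  then show ?thesis using that by blast
qed

context full_branch_system
begin

text \<open>The entropy of the Gibbs weights with parameter \<open>u\<close> on the first \<open>N\<close> branches is
  \<open>u * \<alpha> + ln Z\<close>.\<close>

lemma hausdorff_measure_level_ne_0_gibbs:
  assumes "0 < N" "0 < s" and Z: "Z = (\<Sum>i<N. exp (- u * rate i))"
    and mean: "(\<Sum>i<N. rate i * exp (- u * rate i)) / Z = \<alpha>"
    and s: "s * \<alpha> < u * \<alpha> + ln Z"
  shows "hausdorff_measure s (level \<alpha>) \<noteq> 0"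
proof -
  have "0 < Z" unfolding Z using \<open>0 < N\<close> by (intro sum_pos) auto
  define w where "w i = exp (- u * rate i) / Z" for i
  have w: "(\<Sum>i<N. w i) = 1"
    unfolding w_def sum_divide_distrib[symmetric] Z[symmetric] using \<open>0 < Z\<close> by simp
  obtain p where p: "pmf p = (\<lambda>i. if i < N then w i else 0)"
    by (rule exists_pmf_weights[of N w]) (use w \<open>0 < Z\<close> in \<open>auto simp: w_def\<close>)
  have supp: "set_pmf p \<subseteq> {..<N}"
    using set_pmf_iff[of _ p] by (auto simp: p split: if_splits)
  have E: "measure_pmf.expectation p f = (\<Sum>i<N. f i * w i)" for f :: "nat \<Rightarrow> real"
    by (subst integral_measure_pmf_real[of "{..<N}"]) (use supp in \<open>auto simp: p\<close>)
  have mean_eq: "(\<Sum>i<N. rate i * w i) = \<alpha>"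
    unfolding mean[symmetric] by (simp add: w_def sum_divide_distrib)
  have "measure_pmf.expectation p (\<lambda>i. - ln (pmf p i)) = (\<Sum>i<N. (u * rate i + ln Z) * w i)"
    unfolding E by (intro sum.cong) (use \<open>0 < Z\<close> in \<open>auto simp: p w_def ln_div\<close>)
  also have "\<dots> = u * (\<Sum>i<N. rate i * w i) + ln Z * (\<Sum>i<N. w i)"
    by (simp add: distrib_right sum.distrib sum_distrib_left mult.assoc)
  finally have "measure_pmf.expectation p (\<lambda>i. - ln (pmf p i)) = u * \<alpha> + ln Z"
    using mean_eq w by simp
  moreover have "measure_pmf.expectation p rate = \<alpha>" using E mean_eq by simp
  ultimately show ?thesis
    using hausdorff_measure_level_ne_0[of p s \<alpha>] finite_subset[OF supp] \<open>0 < s\<close> s by simp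
qed

end

context entire_pressure_system
begin

text \<open>Keeping only the first \<open>N\<close> branches changes the mean at \<open>t\<close>. But the exact means at
  \<open>t - e\<close> and \<open>t + e\<close> lie strictly on either side of \<open>mean t\<close>, and so do those of the first \<open>N\<close>
  branches for large \<open>N\<close>. Hence some \<open>u\<close> between \<open>t - e\<close> and \<open>t + e\<close> has mean exactly \<open>mean t\<close> for
  these branches, and the loss in the dimension bound is small with \<open>e\<close>.\<close>

lemma hausdorff_measure_level_ne_0_mean:
  assumes "0 < t" "0 < s" and s: "s < t + pressure t / mean t"
  shows "hausdorff_measure s (level (mean t)) \<noteq> 0"
proof -
  define \<alpha> where "\<alpha> = mean t"
  have \<alpha>: "0 < \<alpha>" using mean_pos[OF assms(1)] by (simp add: \<alpha>_def)
  have cont: "isCont pressure t" using pressure_has_derivative[OF assms(1)] by (rule DERIV_isCont)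
  have "((\<lambda>e. t + e) \<longlongrightarrow> t + 0) (at_right 0)" by (intro tendsto_intros)
  then have "((\<lambda>e. pressure (t + e)) \<longlongrightarrow> pressure t) (at_right 0)"
    by (intro isCont_tendsto_compose[OF cont]) simp
  then have "((\<lambda>e. (t - e) + pressure (t + e) / \<alpha>) \<longlongrightarrow> (t - 0) + pressure t / \<alpha>) (at_right 0)"
    using \<alpha> by (intro tendsto_intros) auto
  then have "\<forall>\<^sub>F e in at_right 0. s < (t - e) + pressure (t + e) / \<alpha>"
    using s by (intro order_tendstoD(1)) (auto simp: \<alpha>_def)
  moreover have "\<forall>\<^sub>F e in at_right 0. e < t"
    using assms(1) by (auto simp: eventually_at_right_field)
  ultimately have "\<forall>\<^sub>F e in at_right 0. s < (t - e) + pressure (t + e) / \<alpha> \<and> e < t \<and> 0 < e"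
    by (intro eventually_conj) (auto simp: eventually_at_filter)
  from eventually_happens[OF this] obtain e
    where e: "s < (t - e) + pressure (t + e) / \<alpha>" "e < t" "0 < e" by auto
  define Z where "Z k N u = (\<Sum>i<N. rate i ^ k * exp (- u * rate i))" for k :: nat and N u
  have Z_lim: "(\<lambda>N. Z k N u) \<longlonglongrightarrow> moment k u" if "0 < u" for k u
    unfolding Z_def moment_def by (rule summable_LIMSEQ[OF summable_moment[OF that]])
  have mean_lim: "(\<lambda>N. Z 1 N u / Z 0 N u) \<longlonglongrightarrow> mean u" if "0 < u" for u
    unfolding mean_def using moment_pos[OF that, of 0] by (intro tendsto_intros Z_lim that) auto
  have pressure_lim: "(\<lambda>N. ln (Z 0 N u)) \<longlonglongrightarrow> pressure u" if "0 < u" for u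
    unfolding pressure_def using moment_pos[OF that, of 0] by (intro tendsto_intros Z_lim that) auto
  have "(\<lambda>N. (t - e) + ln (Z 0 N (t + e)) / \<alpha>) \<longlonglongrightarrow> (t - e) + pressure (t + e) / \<alpha>"
    using \<alpha> assms(1) e by (intro tendsto_intros pressure_lim) auto
  then have "\<forall>\<^sub>F N in sequentially. s < (t - e) + ln (Z 0 N (t + e)) / \<alpha>"
    using e by (intro order_tendstoD(1)) auto
  moreover have "\<forall>\<^sub>F N in sequentially. \<alpha> < Z 1 N (t - e) / Z 0 N (t - e)"
    using mean_strict_antimono[of "t - e" t] e
    by (intro order_tendstoD(1)[OF mean_lim]) (auto simp: \<alpha>_def)
  moreover have "\<forall>\<^sub>F N in sequentially. Z 1 N (t + e) / Z 0 N (t + e) < \<alpha>"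
    using mean_strict_antimono[of t "t + e"] e assms(1)
    by (intro order_tendstoD(2)[OF mean_lim]) (auto simp: \<alpha>_def)
  ultimately have "\<forall>\<^sub>F N in sequentially. s < (t - e) + ln (Z 0 N (t + e)) / \<alpha> \<and>
      \<alpha> < Z 1 N (t - e) / Z 0 N (t - e) \<and> Z 1 N (t + e) / Z 0 N (t + e) < \<alpha> \<and> 0 < N"
    by (intro eventually_conj eventually_gt_at_top)
  from eventually_happens[OF this] obtain N
    where N: "s < (t - e) + ln (Z 0 N (t + e)) / \<alpha>" "0 < N"
      "\<alpha> < Z 1 N (t - e) / Z 0 N (t - e)" "Z 1 N (t + e) / Z 0 N (t + e) < \<alpha>" by auto
  have Z0: "0 < Z 0 N u" for u unfolding Z_def using N(2) by (intro sum_pos) auto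
  have "continuous_on {t - e..t + e} (\<lambda>u. Z 1 N u / Z 0 N u)"
    using Z0 unfolding Z_def by (intro continuous_intros) (force dest: less_imp_neq)
  then obtain u where u: "t - e \<le> u" "u \<le> t + e" "Z 1 N u / Z 0 N u = \<alpha>"
    using IVT2'[of "\<lambda>u. Z 1 N u / Z 0 N u" "t + e" \<alpha> "t - e"] N e by auto
  have "Z 0 N (t + e) \<le> Z 0 N u"
    unfolding Z_def
  proof (rule sum_mono)
    fix i
    have "u * rate i \<le> (t + e) * rate i" using u rate_pos[of i] by (intro mult_right_mono) auto
    then show "rate i ^ 0 * exp (- (t + e) * rate i) \<le> rate i ^ 0 * exp (- u * rate i)"
      by (simp add: algebra_simps)
  qed
  then have "ln (Z 0 N (t + e)) \<le> ln (Z 0 N u)" using Z0 by simp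
  have "s < (t - e) + ln (Z 0 N (t + e)) / \<alpha>" by (rule N(1))
  also have "\<dots> \<le> u + ln (Z 0 N u) / \<alpha>"
    using u \<alpha> \<open>ln (Z 0 N (t + e)) \<le> ln (Z 0 N u)\<close> by (intro add_mono divide_right_mono) auto
  finally have "s * \<alpha> < u * \<alpha> + ln (Z 0 N u)" using \<alpha> by (simp add: field_simps)
  then show ?thesis
    using hausdorff_measure_level_ne_0_gibbs[of N s "Z 0 N u" u \<alpha>] N(2) assms(2) u(3)
    by (simp add: Z_def \<alpha>_def)
qed

text \<open>The two bounds for the Hausdorff measure determine the dimension. They also show that the level
  set is nonempty, because the empty set has measure zero in every positive dimension.\<close>

theorem lyapunov_spectrum_mean:
  assumes "0 < t" "0 < pressure t"
  shows "lyapunov_spectrum X T (mean t) = t + pressure t / mean t"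
    and "mean t \<in> lyapunov_values X T"
proof -
  let ?v = "t + pressure t / mean t"
  have v: "0 < ?v" using assms mean_pos[of t] by (auto intro!: add_pos_pos)
  have F: "exp (pressure t) = (\<Sum>i. r i powr t)"
    using moment_pos[OF assms(1), of 0] unfolding r_powr by (simp add: pressure_def) (simp add: moment_def)
  have "hausdorff_dim (level (mean t)) = ennreal ?v"
  proof (rule hausdorff_dim_eqI[OF v])
    show "hausdorff_measure s (level (mean t)) = 0" if "?v < s" for s
      using hausdorff_measure_level_eq_0[OF summable_r_powr[OF assms(1)] F] assms that mean_pos[of t]
      by simp
    show "hausdorff_measure s (level (mean t)) \<noteq> 0" if "0 < s" "s < ?v" for s
      using hausdorff_measure_level_ne_0_mean[OF assms(1) that] .
  qed
  then show "lyapunov_spectrum X T (mean t) = ?v"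
    unfolding lyapunov_spectrum_def level_def[symmetric] using v by simp
  obtain w where w: "0 < w" "w < ?v" using dense[OF v] by blast
  have "hausdorff_measure w ({} :: real set) = 0"
    by (rule hausdorff_measure_eq_0_I, rule exI[of _ "\<lambda>_. {}"]) (auto simp: hausdorff_cover_def)
  then have "level (mean t) \<noteq> {}"
    using hausdorff_measure_level_ne_0_mean[OF assms(1) w] by metis
  then show "mean t \<in> lyapunov_values X T"
    by (auto simp: level_def lyapunov_values_def)
qed

end

section \<open>Inflections of the spectrum\<close>

text \<open>Fixing one parameter \<open>t0\<close> with positive pressure restricts attention to a half-line of
  exponents, on which the pressure at the corresponding parameter stays positive.\<close>

locale spectrum_tail = entire_pressure_system +
  fixes t0 :: real
  assumes t0_pos: "0 < t0" and pressure_t0: "0 < pressure t0"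
begin

definition tail :: "real set" where
  "tail = {mean t0<..}"

text \<open>The inverse of \<open>mean\<close> on \<open>(0, t0)\<close>.\<close>

definition \<tau> :: "real \<Rightarrow> real" where
  "\<tau> \<alpha> = (THE t. 0 < t \<and> t < t0 \<and> mean t = \<alpha>)"

abbreviation L :: "real \<Rightarrow> real" where
  "L \<equiv> lyapunov_spectrum X T"

lemma mean_in_tail: "0 < t \<Longrightarrow> t < t0 \<Longrightarrow> mean t \<in> tail"
  by (simp add: tail_def mean_strict_antimono)

lemma mean_inj: "0 < s \<Longrightarrow> 0 < t \<Longrightarrow> mean s = mean t \<Longrightarrow> s = t"
  using mean_strict_antimono[of s t] mean_strict_antimono[of t s] by (cases s t rule: linorder_cases) auto

lemma \<tau>_mean: "0 < t \<Longrightarrow> t < t0 \<Longrightarrow> \<tau> (mean t) = t"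
  unfolding \<tau>_def by (rule the_equality) (auto intro: mean_inj)

lemma tail_obtain:
  assumes "\<alpha> \<in> tail"
  obtains t where "0 < t" "t < t0" "mean t = \<alpha>"
proof -
  obtain t1 where t1: "0 < t1" "t1 < t0" "\<alpha> < mean t1" using mean_unbounded_at_0[OF t0_pos] by blast
  have "continuous_on {t1..t0} mean"
    using t1 by (intro DERIV_continuous_on[of _ _ "\<lambda>t. - variance t"])
      (auto intro!: has_field_derivative_at_within mean_has_derivative)
  then obtain t where t: "t1 \<le> t" "t \<le> t0" "mean t = \<alpha>"
    using IVT2'[of mean t0 \<alpha> t1] t1 assms by (auto simp: tail_def)
  moreover have "t \<noteq> t0" using t assms by (auto simp: tail_def)
  ultimately show ?thesis using t1 by (intro that[of t]) auto
qed

lemma \<tau>: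
  assumes "\<alpha> \<in> tail"
  shows "0 < \<tau> \<alpha>" "\<tau> \<alpha> < t0" "mean (\<tau> \<alpha>) = \<alpha>"
  using tail_obtain[OF assms] \<tau>_mean by metis+

lemma tail_pos: "\<alpha> \<in> tail \<Longrightarrow> 0 < \<alpha>"
  using mean_pos[OF t0_pos] by (simp add: tail_def)

lemma open_tail: "open tail"
  by (simp add: tail_def)

lemma pressure_\<tau>_pos: "\<alpha> \<in> tail \<Longrightarrow> 0 < pressure (\<tau> \<alpha>)"
  using pressure_strict_antimono[of "\<tau> \<alpha>" t0] \<tau>[of \<alpha>] pressure_t0 by simp

lemma \<tau>_has_derivative:
  assumes "\<alpha> \<in> tail"
  shows "(\<tau> has_real_derivative - inverse (variance (\<tau> \<alpha>))) (at \<alpha>)"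
proof -
  note \<tau>\<alpha> = \<tau>[OF assms]
  define d where "d = min (\<tau> \<alpha>) (t0 - \<tau> \<alpha>) / 2"
  have d: "0 < d" "d < \<tau> \<alpha>" "d < t0 - \<tau> \<alpha>" using \<tau>\<alpha> by (auto simp: d_def)
  have "isCont \<tau> (mean (\<tau> \<alpha>))"
  proof (rule isCont_inverse_function[where f = mean and x = "\<tau> \<alpha>", OF d(1)])
    fix z assume "\<bar>z - \<tau> \<alpha>\<bar> \<le> d"
    then have z: "0 < z" "z < t0" using d by auto
    then show "\<tau> (mean z) = z" by (rule \<tau>_mean)
    show "isCont mean z" using mean_has_derivative[OF z(1)] by (rule DERIV_isCont)
  qed
  then have "(\<tau> has_real_derivative inverse (- variance (\<tau> \<alpha>))) (at \<alpha>)"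
    using assms \<tau>\<alpha> variance_pos[of "\<tau> \<alpha>"] mean_has_derivative[of "\<tau> \<alpha>"]
    by (intro DERIV_inverse_function[where f = mean and a = "mean t0" and b = "\<alpha> + 1"])
      (auto simp: tail_def \<tau>)
  then show ?thesis by simp
qed

text \<open>The formula \<open>\<tau>' = - 1 / variance \<circ> \<tau>\<close> raises the order of differentiability of \<open>\<tau>\<close> by one.\<close>

lemma times_differentiable_on_\<tau>: "times_differentiable_on n tail \<tau>"
proof (induction n)
  case (Suc n)
  have "times_differentiable_on n tail (\<lambda>\<alpha>. variance (\<tau> \<alpha>))"
    by (rule times_differentiable_on_compose[OF times_differentiable_on_variance Suc]) (simp add: \<tau>)
  moreover have "variance (\<tau> \<alpha>) \<noteq> 0" if "\<alpha> \<in> tail" for \<alpha>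
    using variance_pos[OF \<tau>(1)[OF that]] by simp
  ultimately have "times_differentiable_on n tail (\<lambda>\<alpha>. - inverse (variance (\<tau> \<alpha>)))"
    by (intro times_differentiable_on_uminus times_differentiable_on_inverse)
  then show ?case
    by (rule times_differentiable_on_SucI[OF \<tau>_has_derivative, rotated])
qed simp

lemma L_eq: "\<alpha> \<in> tail \<Longrightarrow> L \<alpha> = \<tau> \<alpha> + pressure (\<tau> \<alpha>) / \<alpha>"
  using lyapunov_spectrum_mean(1)[of "\<tau> \<alpha>"] \<tau>[of \<alpha>] pressure_\<tau>_pos[of \<alpha>] by simp

lemma tail_subset_interior_values: "tail \<subseteq> interior (lyapunov_values X T)"
proof (rule interior_maximal[OF _ open_tail])
  show "tail \<subseteq> lyapunov_values X T"
    using lyapunov_spectrum_mean(2)[of "\<tau> _"] \<tau> pressure_\<tau>_pos by fastforce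
qed

lemma times_differentiable_on_L: "times_differentiable_on n tail L"
proof (rule times_differentiable_on_cong[OF open_tail])
  show "times_differentiable_on n tail (\<lambda>\<alpha>. \<tau> \<alpha> + pressure (\<tau> \<alpha>) * inverse \<alpha>)"
    using tail_pos
    by (intro times_differentiable_on_add times_differentiable_on_mult times_differentiable_on_\<tau> times_differentiable_on_inverse times_differentiable_on_id times_differentiable_on_compose[OF times_differentiable_on_pressure times_differentiable_on_\<tau>])
      (auto simp: \<tau> dest: less_imp_neq)
qed (simp add: L_eq divide_inverse)

text \<open>The terms that contain \<open>\<tau>'\<close> cancel, since \<open>\<tau> \<alpha>\<close> is the critical point of
  \<open>t + pressure t / \<alpha>\<close>.\<close>

lemma L_has_derivative:
  assumes "\<alpha> \<in> tail"
  shows "(L has_real_derivative - pressure (\<tau> \<alpha>) / \<alpha>\<^sup>2) (at \<alpha>)"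
proof -
  let ?t' = "- inverse (variance (\<tau> \<alpha>))"
  have "((\<lambda>\<alpha>. pressure (\<tau> \<alpha>)) has_real_derivative - mean (\<tau> \<alpha>) * ?t') (at \<alpha>)"
    using assms by (intro DERIV_chain2[OF pressure_has_derivative] \<tau>_has_derivative \<tau>)
  then have "((\<lambda>\<alpha>. \<tau> \<alpha> + pressure (\<tau> \<alpha>) / \<alpha>) has_real_derivative
      ?t' + (- mean (\<tau> \<alpha>) * ?t' * \<alpha> - pressure (\<tau> \<alpha>) * 1) / (\<alpha> * \<alpha>)) (at \<alpha>)"
    using tail_pos[OF assms] \<tau>_has_derivative[OF assms]
    by (intro DERIV_add DERIV_divide DERIV_ident) auto
  also have "?t' + (- mean (\<tau> \<alpha>) * ?t' * \<alpha> - pressure (\<tau> \<alpha>) * 1) / (\<alpha> * \<alpha>) = - pressure (\<tau> \<alpha>) / \<alpha>\<^sup>2"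
    unfolding \<tau>(3)[OF assms] using tail_pos[OF assms] by (simp add: field_simps power2_eq_square)
  finally show ?thesis
    using open_tail assms by (rule has_field_derivative_transform_within_open) (simp add: L_eq)
qed

lemma deriv_L: "\<alpha> \<in> tail \<Longrightarrow> deriv L \<alpha> = - pressure (\<tau> \<alpha>) / \<alpha>\<^sup>2"
  by (rule DERIV_imp_deriv[OF L_has_derivative])

lemma second_deriv_L:
  assumes "\<alpha> \<in> tail"
  shows "(deriv ^^ 2) L \<alpha> = (2 * pressure (\<tau> \<alpha>) * variance (\<tau> \<alpha>) - \<alpha>\<^sup>2) / (\<alpha> ^ 3 * variance (\<tau> \<alpha>))"
proof -
  let ?V = "variance (\<tau> \<alpha>)"
  have V: "0 < ?V" by (rule variance_pos) (rule \<tau>[OF assms])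
  have "((\<lambda>\<alpha>. pressure (\<tau> \<alpha>)) has_real_derivative - mean (\<tau> \<alpha>) * - inverse ?V) (at \<alpha>)"
    using assms by (intro DERIV_chain2[OF pressure_has_derivative] \<tau>_has_derivative \<tau>)
  then have "((\<lambda>\<alpha>. - pressure (\<tau> \<alpha>) / \<alpha>\<^sup>2) has_real_derivative
      (- (- mean (\<tau> \<alpha>) * - inverse ?V) * \<alpha>\<^sup>2 - - pressure (\<tau> \<alpha>) * (2 * \<alpha>)) / (\<alpha>\<^sup>2 * \<alpha>\<^sup>2)) (at \<alpha>)"
    using tail_pos[OF assms]
    by (intro DERIV_divide DERIV_minus) (auto intro!: derivative_eq_intros)
  also have "(- (- mean (\<tau> \<alpha>) * - inverse ?V) * \<alpha>\<^sup>2 - - pressure (\<tau> \<alpha>) * (2 * \<alpha>)) / (\<alpha>\<^sup>2 * \<alpha>\<^sup>2)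
      = (2 * pressure (\<tau> \<alpha>) * ?V - \<alpha>\<^sup>2) / (\<alpha> ^ 3 * ?V)"
    unfolding \<tau>(3)[OF assms] using tail_pos[OF assms] V
    by (simp add: field_simps power2_eq_square power3_eq_cube)
  finally have "(deriv L has_real_derivative
      (2 * pressure (\<tau> \<alpha>) * ?V - \<alpha>\<^sup>2) / (\<alpha> ^ 3 * ?V)) (at \<alpha>)"
    using open_tail assms by (rule has_field_derivative_transform_within_open) (simp add: deriv_L)
  then show ?thesis by (simp add: numeral_2_eq_2 DERIV_imp_deriv)
qed

lemma funpow_deriv_L_has_derivative:
  "\<alpha> \<in> tail \<Longrightarrow> ((deriv ^^ n) L has_real_derivative (deriv ^^ Suc n) L \<alpha>) (at \<alpha>)"
  by (rule smooth_funpow_deriv_differentiable[OF open_tail times_differentiable_on_L])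

text \<open>Otherwise the negative slope of \<open>L\<close> at \<open>c\<close> would persist and \<open>L\<close> would become negative.\<close>

lemma not_eventually_concave:
  assumes "c \<in> tail"
  shows "\<exists>\<alpha>>c. 0 < (deriv ^^ 2) L \<alpha>"
proof (rule ccontr)
  assume contra: "\<not> ?thesis"
  have concave: "(deriv ^^ 2) L \<alpha> \<le> 0" if "c < \<alpha>" for \<alpha> using contra that not_less by blast
  have inS: "\<alpha> \<in> tail" if "c \<le> \<alpha>" for \<alpha> using that assms by (simp add: tail_def)
  define d where "d = - deriv L c"
  have "0 < d"
    using tail_pos[OF assms] pressure_\<tau>_pos[OF assms] by (simp add: d_def deriv_L[OF assms])
  have slope: "deriv L \<alpha> \<le> - d" if "c \<le> \<alpha>" for \<alpha>
  proof (cases "c = \<alpha>")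
    case False
    with that have "c < \<alpha>" by simp
    from MVT2[OF this, of "deriv L" "(deriv ^^ 2) L"] obtain z
      where "c < z" "deriv L \<alpha> - deriv L c = (\<alpha> - c) * (deriv ^^ 2) L z"
      using funpow_deriv_L_has_derivative[OF inS, of _ 1] by (auto simp: numeral_2_eq_2)
    moreover have "(\<alpha> - c) * (deriv ^^ 2) L z \<le> 0"
      using \<open>c < \<alpha>\<close> concave[OF \<open>c < z\<close>] by (simp add: mult_le_0_iff)
    ultimately show ?thesis by (simp add: d_def)
  qed (simp add: d_def)
  \<comment> \<open>The tangent line of slope \<open>- d\<close> through \<open>(c, L c)\<close> takes the value \<open>- 1\<close> at \<open>b\<close>.\<close>
  define b where "b = c + (L c + 1) / d"
  have "0 < L c"
    unfolding L_eq[OF assms] using \<tau>[OF assms] tail_pos[OF assms] pressure_\<tau>_pos[OF assms]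
    by (intro add_pos_pos) auto
  then have "c < b" using \<open>0 < d\<close> by (simp add: b_def)
  from MVT2[OF this, of L "deriv L"] obtain z
    where z: "c < z" "L b - L c = (b - c) * deriv L z"
    using funpow_deriv_L_has_derivative[OF inS, of _ 0] by auto
  have "(b - c) * deriv L z \<le> (b - c) * (- d)"
    using slope[of z] z \<open>c < b\<close> by (intro mult_left_mono) auto
  also have "\<dots> = - (L c + 1)" using \<open>0 < d\<close> by (simp add: b_def)
  finally have "L b < 0" using z by simp
  moreover have "0 < L b"
    using inS[of b] \<open>c < b\<close> \<tau>[of b] tail_pos[of b] pressure_\<tau>_pos[of b]
    by (simp add: L_eq add_pos_pos)
  ultimately show False by simp
qed

text \<open>At \<open>\<alpha> = mean t\<close>, the second derivatives of \<open>L\<close> and of \<open>sqrt p\<close> have the same sign, that of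
  \<open>2 * pressure t * variance t - (mean t)\<^sup>2\<close>. Large \<open>\<alpha>\<close> correspond to small \<open>t\<close>.\<close>

lemma sqrt_pressure_convex_if_L_convex:
  assumes "c \<in> tail" and convex: "\<And>\<alpha>. c < \<alpha> \<Longrightarrow> 0 \<le> (deriv ^^ 2) L \<alpha>"
  shows "convex_on {0<..<\<tau> c} (\<lambda>t. sqrt (pressure t))"
proof (rule f''_ge0_imp_convex)
  show "convex {0<..<\<tau> c}" by simp
  fix t assume t: "t \<in> {0<..<\<tau> c}"
  then have t': "0 < t" "t < t0" using \<tau>[OF assms(1)] by auto
  define q where "q = sqrt (pressure t)"
  have p: "0 < pressure t" using pressure_strict_antimono[OF t'] pressure_t0 by simp
  then have q: "0 < q" "pressure t = q\<^sup>2" by (auto simp: q_def)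
  have sqrt_deriv: "((\<lambda>t. sqrt (pressure t)) has_real_derivative - mean t / (2 * sqrt (pressure t))) (at t)"
    using DERIV_chain2[OF DERIV_real_sqrt[OF p] pressure_has_derivative[OF t'(1)]]
    by (simp add: field_simps)
  then show "((\<lambda>t. sqrt (pressure t)) has_real_derivative - mean t / (2 * sqrt (pressure t))) (at t)" .
  have "((\<lambda>t. - mean t / (2 * sqrt (pressure t))) has_real_derivative
      (- (- variance t) * (2 * q) - (- mean t) * (2 * (- mean t / (2 * q)))) / ((2 * q) * (2 * q))) (at t)"
    unfolding q_def using p
    by (intro DERIV_divide DERIV_minus DERIV_cmult mean_has_derivative[OF t'(1)] sqrt_deriv) auto
  also have "(- (- variance t) * (2 * q) - (- mean t) * (2 * (- mean t / (2 * q)))) / ((2 * q) * (2 * q))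
      = (2 * q\<^sup>2 * variance t - (mean t)\<^sup>2) / (4 * q ^ 3)"
    using q(1) by (simp add: field_simps power2_eq_square power3_eq_cube)
  finally show "((\<lambda>t. - mean t / (2 * sqrt (pressure t))) has_real_derivative
      (2 * (sqrt (pressure t))\<^sup>2 * variance t - (mean t)\<^sup>2) / (4 * sqrt (pressure t) ^ 3)) (at t)"
    by (simp only: q_def)
  have "c < mean t" using mean_strict_antimono[of t "\<tau> c"] t \<tau>[OF assms(1)] by simp
  with convex[OF this] have "0 \<le> (2 * pressure t * variance t - (mean t)\<^sup>2) / (mean t ^ 3 * variance t)"
    using second_deriv_L[OF mean_in_tail[OF t']] by (simp add: \<tau>_mean[OF t'])
  moreover have "0 < mean t ^ 3 * variance t"
    using mean_pos[OF t'(1)] variance_pos[OF t'(1)] by simp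
  ultimately have "0 \<le> 2 * pressure t * variance t - (mean t)\<^sup>2"
    by (simp add: zero_le_divide_iff)
  then show "0 \<le> (2 * (sqrt (pressure t))\<^sup>2 * variance t - (mean t)\<^sup>2) / (4 * sqrt (pressure t) ^ 3)"
    using p by simp
qed

text \<open>The points \<open>t\<close>, \<open>5 * t\<close>, \<open>9 * t\<close> test midpoint convexity at every small scale.\<close>

lemma not_eventually_convex:
  assumes osc: "\<And>\<epsilon>. 0 < \<epsilon> \<Longrightarrow> \<exists>t>0. 9 * t < \<epsilon> \<and>
      sqrt (pressure t) + sqrt (pressure (9 * t)) < 2 * sqrt (pressure (5 * t))"
    and "c \<in> tail"
  shows "\<exists>\<alpha>>c. (deriv ^^ 2) L \<alpha> < 0"
proof (rule ccontr)
  assume contra: "\<not> ?thesis"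
  have "0 \<le> (deriv ^^ 2) L \<alpha>" if "c < \<alpha>" for \<alpha> using contra that not_less by blast
  then have convex: "convex_on {0<..<\<tau> c} (\<lambda>t. sqrt (pressure t))"
    by (intro sqrt_pressure_convex_if_L_convex assms)
  obtain t where t: "0 < t" "9 * t < \<tau> c"
    and less: "sqrt (pressure t) + sqrt (pressure (9 * t)) < 2 * sqrt (pressure (5 * t))"
    using osc[OF \<tau>(1)[OF assms(2)]] by blast
  have "sqrt (pressure ((1 - 1 / 2) *\<^sub>R t + (1 / 2) *\<^sub>R (9 * t)))
      \<le> (1 - 1 / 2) * sqrt (pressure t) + (1 / 2) * sqrt (pressure (9 * t))"
    using t by (intro convex_onD[OF convex]) auto
  moreover have "(1 - 1 / 2) *\<^sub>R t + (1 / 2) *\<^sub>R (9 * t) = 5 * t" by simp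
  ultimately show False using less by simp
qed

lemma second_deriv_L_zeros_unbounded:
  assumes osc: "\<And>\<epsilon>. 0 < \<epsilon> \<Longrightarrow> \<exists>t>0. 9 * t < \<epsilon> \<and>
      sqrt (pressure t) + sqrt (pressure (9 * t)) < 2 * sqrt (pressure (5 * t))"
    and "c \<in> tail"
  shows "\<exists>\<alpha>>c. (deriv ^^ 2) L \<alpha> = 0"
proof -
  obtain u v where u: "c < u" "0 < (deriv ^^ 2) L u" and v: "c < v" "(deriv ^^ 2) L v < 0"
    using not_eventually_concave[OF assms(2)] not_eventually_convex[OF assms] by blast
  have cont: "continuous_on {min u v..max u v} ((deriv ^^ 2) L)"
  proof (rule continuous_at_imp_continuous_on, rule ballI)
    fix x assume "x \<in> {min u v..max u v}"
    then have "x \<in> tail" using assms(2) u v by (auto simp: tail_def)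
    then show "isCont ((deriv ^^ 2) L) x"
      by (rule DERIV_isCont[OF funpow_deriv_L_has_derivative])
  qed
  have "\<exists>x\<ge>min u v. x \<le> max u v \<and> (deriv ^^ 2) L x = 0"
  proof (cases "u \<le> v")
    case True
    with cont u v show ?thesis using IVT2'[of "(deriv ^^ 2) L" v 0 u] by auto
  next
    case False
    with cont u v show ?thesis using IVT'[of "(deriv ^^ 2) L" v 0 u] by auto
  qed
  then obtain x where x: "min u v \<le> x" "(deriv ^^ 2) L x = 0" by blast
  moreover have "c < min u v" using u v by simp
  ultimately have "c < x" by linarith
  with x(2) show ?thesis by blast
qed

text \<open>Rolle's theorem puts a zero of the next derivative between two zeros beyond \<open>c\<close>.\<close>

lemma higher_deriv_L_zeros_unbounded:
  assumes osc: "\<And>\<epsilon>. 0 < \<epsilon> \<Longrightarrow> \<exists>t>0. 9 * t < \<epsilon> \<and>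
      sqrt (pressure t) + sqrt (pressure (9 * t)) < 2 * sqrt (pressure (5 * t))"
    and "2 \<le> k" "c \<in> tail"
  shows "\<exists>\<alpha>>c. (deriv ^^ k) L \<alpha> = 0"
  using assms(2,3)
proof (induction k arbitrary: c rule: dec_induct)
  case base
  then show ?case by (intro second_deriv_L_zeros_unbounded osc)
next
  case (step k)
  obtain u where u: "c < u" "(deriv ^^ k) L u = 0" using step by blast
  then have "u \<in> tail" using step.prems by (simp add: tail_def)
  then obtain v where v: "u < v" "(deriv ^^ k) L v = 0" using step.IH by blast
  have der: "((deriv ^^ k) L has_real_derivative (deriv ^^ Suc k) L x) (at x)" if "u \<le> x" for x
    using that \<open>u \<in> tail\<close> by (intro funpow_deriv_L_has_derivative) (simp add: tail_def)
  obtain z where "u < z" "(deriv ^^ k) L v - (deriv ^^ k) L u = (v - u) * (deriv ^^ Suc k) L z"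
    using MVT2[OF v(1), of "(deriv ^^ k) L" "(deriv ^^ Suc k) L"] der by blast
  with u v have "(deriv ^^ Suc k) L z = 0" "c < z" by auto
  then show ?case by blast
qed

theorem infinite_zeros_of_higher_derivs:
  assumes osc: "\<And>\<epsilon>. 0 < \<epsilon> \<Longrightarrow> \<exists>t>0. 9 * t < \<epsilon> \<and>
      sqrt (pressure t) + sqrt (pressure (9 * t)) < 2 * sqrt (pressure (5 * t))"
    and "2 \<le> k"
  shows "infinite {\<alpha> \<in> interior (lyapunov_values X T).
      times_differentiable_at k L \<alpha> \<and> (deriv ^^ k) L \<alpha> = 0}"
proof
  let ?A = "{\<alpha> \<in> interior (lyapunov_values X T). times_differentiable_at k L \<alpha> \<and> (deriv ^^ k) L \<alpha> = 0}"
  assume fin: "finite ?A"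
  define c where "c = Max (insert (mean t0 + 1) ?A)"
  have "mean t0 + 1 \<le> c" using fin by (simp add: c_def)
  then have "c \<in> tail" by (simp add: tail_def)
  then obtain \<alpha> where \<alpha>: "c < \<alpha>" "(deriv ^^ k) L \<alpha> = 0"
    using higher_deriv_L_zeros_unbounded[OF assms] by blast
  then have "\<alpha> \<in> tail" using \<open>c \<in> tail\<close> by (simp add: tail_def)
  then have "\<alpha> \<in> ?A"
    using \<alpha>(2) tail_subset_interior_values smooth_times_differentiable_at[OF open_tail times_differentiable_on_L] by auto
  then have "\<alpha> \<le> c" unfolding c_def using fin by (intro Max_ge) auto
  with \<alpha> show False by simp
qed

end

section \<open>A system whose pressure oscillates\<close>

text \<open>Block \<open>k\<close> consists of the indices below \<open>2 ^ block_exp k\<close> that belong to no earlier block. Its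
  branches have length \<open>2 powr - depth k\<close>, so at the parameter \<open>t\<close> they contribute about
  \<open>2 powr (block_exp k - depth k * t)\<close> to the partition sum. The factor \<open>100\<close> makes earlier blocks
  negligible near \<open>crit_scale k\<close>, where \<open>depth k * crit_scale k = block_exp k / 10\<close>; the factor \<open>20\<close>
  makes later blocks negligible there.\<close>

definition block_exp :: "nat \<Rightarrow> nat" where
  "block_exp k = 100 ^ Suc k"

definition depth :: "nat \<Rightarrow> nat" where
  "depth k = 4 * 20 ^ k * block_exp k"

definition block_of :: "nat \<Rightarrow> nat" where
  "block_of i = (LEAST k. i < 2 ^ block_exp k)"

definition branch_len :: "nat \<Rightarrow> real" where
  "branch_len i = (1 / 2) ^ depth (block_of i)"

definition branch_left :: "nat \<Rightarrow> real" where
  "branch_left i = 1 / (real i + 2)"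

definition crit_scale :: "nat \<Rightarrow> real" where
  "crit_scale k = 1 / (40 * 20 ^ k)"

lemma block_exp_mono: "j \<le> k \<Longrightarrow> block_exp j \<le> block_exp k"
  by (simp add: block_exp_def power_increasing)

lemma block_exp_gt: "k < block_exp k"
proof -
  have "k < 2 ^ k" by (rule less_exp)
  also have "\<dots> \<le> 100 ^ k" by (rule power_mono) auto
  also have "\<dots> \<le> block_exp k" by (simp add: block_exp_def)
  finally show ?thesis .
qed

lemma less_block_of: "i < 2 ^ block_exp (block_of i)"
proof -
  have "i < 2 ^ block_exp i"
  proof -
    have "i < 2 ^ i" by (rule less_exp)
    also have "\<dots> \<le> (2::nat) ^ block_exp i" using block_exp_gt[of i] by (intro power_increasing) auto
    finally show ?thesis .
  qed
  then show ?thesis unfolding block_of_def by (rule LeastI)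
qed

lemma block_of_le_iff: "block_of i \<le> k \<longleftrightarrow> i < 2 ^ block_exp k"
proof
  assume "block_of i \<le> k"
  then have "(2::nat) ^ block_exp (block_of i) \<le> 2 ^ block_exp k" by (intro power_increasing block_exp_mono) auto
  with less_block_of[of i] show "i < 2 ^ block_exp k" by linarith
qed (simp add: block_of_def Least_le)

lemma block_of_eq:
  assumes "2 ^ block_exp k \<le> i" "i < 2 ^ block_exp (Suc k)"
  shows "block_of i = Suc k"
  using assms block_of_le_iff[of i k] block_of_le_iff[of i "Suc k"] by linarith

lemma branch_len_powr: "branch_len i powr t = 2 powr (- (real (depth (block_of i)) * t))"
  by (simp add: branch_len_def powr_realpow[symmetric] powr_powr powr_divide powr_minus_divide)

text \<open>The assumption bounds the power by \<open>2 powr (- 2 * block_exp (block_of i))\<close>, and \<open>i\<close> is below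
  \<open>2 ^ block_exp (block_of i)\<close>.\<close>

lemma branch_len_le:
  assumes "2 * real (block_exp (block_of i)) \<le> real (depth (block_of i)) * t"
  shows "branch_len i powr t \<le> 1 / (real i + 1)\<^sup>2"
proof -
  let ?b = "block_exp (block_of i)"
  have "branch_len i powr t \<le> 2 powr (- real (2 * ?b))"
    unfolding branch_len_powr using assms by (intro powr_mono) auto
  also have "\<dots> = 1 / (2 ^ ?b)\<^sup>2"
    by (simp add: powr_minus_divide powr_realpow power_mult[symmetric] mult.commute del: of_nat_mult)
  also have "\<dots> \<le> 1 / (real i + 1)\<^sup>2"
  proof -
    have "Suc i \<le> 2 ^ ?b" using less_block_of[of i] by simp
    then have "real (Suc i) \<le> real (2 ^ ?b)" by (simp only: of_nat_le_iff)
    then show ?thesis by (intro divide_left_mono power_mono) auto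
  qed
  finally show ?thesis .
qed

text \<open>This lets the \<open>i\<close>-th branch start at \<open>1 / (i + 2)\<close> and end before \<open>1 / (i + 1)\<close>. The
  square root of the length is at most \<open>1 / (i + 1)\<^sup>2\<close> and less than \<open>1 / 2\<close>; in the product of the two
  bounds, the factor \<open>1 / 2\<close> compensates for \<open>i + 2\<close> against \<open>i + 1\<close>.\<close>

lemma branch_len_less: "branch_len i < 1 / ((real i + 1) * (real i + 2))"
proof -
  have "1 \<le> block_exp (block_of i)" by (simp add: block_exp_def)
  have "4 * block_exp (block_of i) \<le> depth (block_of i)" by (simp add: depth_def)
  then have "real (4 * block_exp (block_of i)) \<le> real (depth (block_of i))" by (simp only: of_nat_le_iff)
  then have "branch_len i powr (1 / 2) \<le> 1 / (real i + 1)\<^sup>2" by (intro branch_len_le) simp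
  moreover have "branch_len i powr (1 / 2) = sqrt (branch_len i)"
    by (simp add: powr_half_sqrt branch_len_def)
  ultimately have "sqrt (branch_len i) \<le> 1 / (real i + 1)\<^sup>2" by simp
  moreover have "sqrt (branch_len i) < 1 / 2"
  proof -
    have "branch_len i powr (1 / 2) = 2 powr (- (depth (block_of i) / 2))" by (simp add: branch_len_powr)
    also have "\<dots> < 2 powr (- 1)"
      using \<open>4 * block_exp (block_of i) \<le> depth (block_of i)\<close> \<open>1 \<le> block_exp (block_of i)\<close>
      by (intro powr_less_mono) auto
    finally show ?thesis by (simp add: powr_half_sqrt branch_len_def powr_minus_divide)
  qed
  ultimately have "sqrt (branch_len i) * sqrt (branch_len i) < 1 / (real i + 1)\<^sup>2 * (1 / 2)"
    by (intro mult_le_less_imp_less) (auto simp: branch_len_def)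
  then have "branch_len i < 1 / (2 * (real i + 1)\<^sup>2)" by (simp add: branch_len_def)
  also have "\<dots> \<le> 1 / ((real i + 1) * (real i + 2))"
  proof (intro divide_left_mono mult_pos_pos)
    show "(real i + 1) * (real i + 2) \<le> 2 * (real i + 1)\<^sup>2"
      by (simp add: power2_eq_square algebra_simps)
  qed auto
  finally show ?thesis .
qed

lemma branch_right_end_less: "branch_left i + branch_len i < 1 / (real i + 1)"
proof -
  have "1 / ((real i + 1) * (real i + 2)) = 1 / (real i + 1) - branch_left i"
    by (simp add: branch_left_def field_simps)
  with branch_len_less[of i] show ?thesis by linarith
qed

lemma branch_left_antimono: "i < j \<Longrightarrow> branch_left j + branch_len j < branch_left i"
proof -
  assume "i < j"
  then have "1 / (real j + 1) \<le> branch_left i" unfolding branch_left_def by (intro divide_left_mono) auto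
  with branch_right_end_less[of j] show ?thesis by linarith
qed

text \<open>In a later block \<open>j > k\<close>, the depth has grown by the extra factor \<open>20 ^ (j - k)\<close>, so that
  \<open>depth j * crit_scale k \<ge> 2 * block_exp j\<close>.\<close>

lemma branch_len_tail_le:
  assumes "2 ^ block_exp k \<le> i" "crit_scale k \<le> t"
  shows "branch_len i powr t \<le> 1 / (real i + 1)\<^sup>2"
proof (rule branch_len_le)
  let ?j = "block_of i"
  have "k < ?j" using assms(1) block_of_le_iff[of i k] by linarith
  then have "(20::real) ^ Suc k \<le> 20 ^ ?j" by (intro power_increasing) auto
  then have "2 \<le> 4 * 20 ^ ?j * crit_scale k" by (simp add: crit_scale_def field_simps)
  also have "\<dots> \<le> 4 * 20 ^ ?j * t" using assms(2) by (intro mult_left_mono) auto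
  finally have "2 * real (block_exp ?j) \<le> (4 * 20 ^ ?j * t) * real (block_exp ?j)"
    by (intro mult_right_mono) auto
  then show "2 * real (block_exp ?j) \<le> real (depth ?j) * t" by (simp add: depth_def mult_ac)
qed

lemma crit_scale_pos: "0 < crit_scale k"
  by (simp add: crit_scale_def)

lemma crit_scale_tendsto_0: "crit_scale \<longlonglongrightarrow> 0"
proof -
  have "(\<lambda>k. (1 / 20) ^ k * (1 / 40)) \<longlonglongrightarrow> (0 :: real) * (1 / 40)"
    by (intro tendsto_mult tendsto_const LIMSEQ_power_zero) auto
  moreover have "(\<lambda>k. (1 / 20) ^ k * (1 / 40)) = crit_scale"
    by (simp add: fun_eq_iff crit_scale_def power_one_over)
  ultimately show ?thesis by (simp only: mult_zero_left)
qed

lemma crit_scale_less_ex: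
  assumes "0 < \<epsilon>"
  shows "\<exists>k. crit_scale (Suc k) < \<epsilon>"
proof -
  have "\<forall>\<^sub>F k in sequentially. crit_scale (Suc k) < \<epsilon>"
    using LIMSEQ_Suc[OF crit_scale_tendsto_0] assms by (rule order_tendstoD)
  then show ?thesis by (auto simp: eventually_sequentially)
qed

lemma summable_inverse_squares: "summable (\<lambda>i. 1 / (real i + 1)\<^sup>2)"
  using inverse_squares_sums by (simp add: sums_iff add.commute)

lemma summable_branch_len_powr:
  assumes "0 < t"
  shows "summable (\<lambda>i. branch_len i powr t)"
proof -
  obtain k where "crit_scale (Suc k) < t" using crit_scale_less_ex[OF assms] by blast
  then show ?thesis
    by (intro summable_comparison_test'[OF summable_inverse_squares, of "2 ^ block_exp (Suc k)"])
      (simp add: branch_len_tail_le)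
qed

interpretation example: entire_pressure_system branch_len branch_left
proof
  show "0 < branch_len i" for i by (simp add: branch_len_def)
  show "0 \<le> branch_left i" for i by (simp add: branch_left_def)
  show "branch_left i + branch_len i \<le> 1" for i
  proof -
    have "1 / (real i + 1) \<le> 1" by simp
    with branch_right_end_less[of i] show ?thesis by linarith
  qed
  then show "branch_len i < 1" for i
    using branch_left_def[of i] by (smt (verit) divide_pos_pos of_nat_0_le_iff)
  show "{branch_left i..branch_left i + branch_len i} \<inter> {branch_left j..branch_left j + branch_len j} = {}" if "i \<noteq> j" for i j
    using that branch_left_antimono[of i j] branch_left_antimono[of j i] by (cases i j rule: linorder_cases) auto
  show "summable (\<lambda>i. branch_len i powr t)" if "0 < t" for t by (rule summable_branch_len_powr[OF that])
qed

lemma moment_0_eq: "example.moment 0 t = (\<Sum>i. branch_len i powr t)"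
  by (simp add: example.moment_def example.r_powr)

text \<open>The three summands bound the earlier blocks, block \<open>Suc k\<close> and the later blocks.\<close>

lemma moment_0_upper:
  assumes "crit_scale (Suc k) \<le> t"
  shows "example.moment 0 t \<le> (2::real) ^ block_exp k + 2 powr (real (block_exp (Suc k)) - real (depth (Suc k)) * t) + 2"
proof -
  let ?M = "2 ^ block_exp k :: nat" and ?N = "2 ^ block_exp (Suc k) :: nat"
  have "0 < t" using assms crit_scale_pos[of "Suc k"] by linarith
  note summ = summable_branch_len_powr[OF this]
  have MN: "?M \<le> ?N" by (intro power_increasing block_exp_mono) auto
  have "(\<Sum>i<?M. branch_len i powr t) \<le> (\<Sum>i<?M. 1)"
    using \<open>0 < t\<close> example.r_less_1 example.r_pos by (intro sum_mono powr_le1) (auto simp: less_imp_le)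
  moreover have "(\<Sum>i=?M..<?N. branch_len i powr t) \<le> 2 powr (real (block_exp (Suc k)) - real (depth (Suc k)) * t)"
  proof -
    have "(\<Sum>i=?M..<?N. branch_len i powr t) = (\<Sum>i=?M..<?N. 2 powr (- (real (depth (Suc k)) * t)))"
      by (intro sum.cong) (auto simp: branch_len_powr block_of_eq)
    also have "\<dots> = real (?N - ?M) * 2 powr (- (real (depth (Suc k)) * t))" by simp
    also have "\<dots> \<le> real ?N * 2 powr (- (real (depth (Suc k)) * t))" by (intro mult_right_mono) auto
    also have "\<dots> = 2 powr (real (block_exp (Suc k)) - real (depth (Suc k)) * t)"
      by (simp add: powr_diff powr_minus_divide powr_realpow)
    finally show ?thesis .
  qed
  moreover have "(\<Sum>i. branch_len (i + ?N) powr t) \<le> 2"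
  proof -
    have "(\<Sum>i. branch_len (i + ?N) powr t) \<le> (\<Sum>i. 1 / (real (i + ?N) + 1)\<^sup>2)"
      by (intro suminf_le branch_len_tail_le[of "Suc k"] assms summable_ignore_initial_segment[OF summ]
          summable_ignore_initial_segment[OF summable_inverse_squares]) auto
    also have "\<dots> \<le> (\<Sum>i. 1 / (real i + 1)\<^sup>2)"
      using suminf_split_initial_segment[OF summable_inverse_squares, of ?N]
      by (simp add: sum_nonneg)
    also have "\<dots> = pi\<^sup>2 / 6" using inverse_squares_sums by (simp add: sums_iff add.commute)
    also have "\<dots> \<le> 2"
    proof -
      have "pi\<^sup>2 \<le> (16 / 5)\<^sup>2" using pi_approx by (intro power_mono) auto
      then show ?thesis by (simp add: power2_eq_square)
    qed
    finally show ?thesis .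
  qed
  moreover have "(\<Sum>i. branch_len i powr t) = (\<Sum>i. branch_len (i + ?N) powr t) + (\<Sum>i<?M. branch_len i powr t) + (\<Sum>i=?M..<?N. branch_len i powr t)"
    using suminf_split_initial_segment[OF summ, of ?N] sum.atLeastLessThan_concat[of 0 ?M ?N "\<lambda>i. branch_len i powr t"] MN
    by (simp add: atLeast0LessThan)
  ultimately show ?thesis by (simp add: moment_0_eq)
qed

lemma moment_0_lower:
  assumes "0 < t"
  shows "2 powr (real (block_exp (Suc k)) - 1 - real (depth (Suc k)) * t) \<le> example.moment 0 t"
proof -
  let ?M = "2 ^ block_exp k :: nat" and ?N = "2 ^ block_exp (Suc k) :: nat"
  have "Suc (block_exp k) \<le> block_exp (Suc k)" using block_exp_gt[of k] by (simp add: block_exp_def)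
  then have "(2::nat) ^ Suc (block_exp k) \<le> ?N" by (intro power_increasing) auto
  then have MN: "2 * ?M \<le> ?N" by simp
  have "2 powr (real (block_exp (Suc k)) - 1 - real (depth (Suc k)) * t) = real ?N / 2 * 2 powr (- (real (depth (Suc k)) * t))"
    by (simp add: powr_diff powr_minus_divide powr_realpow)
  also have "\<dots> \<le> real (?N - ?M) * 2 powr (- (real (depth (Suc k)) * t))"
  proof (rule mult_right_mono)
    have "?N \<le> 2 * (?N - ?M)" using MN by simp
    then have "real ?N \<le> real (2 * (?N - ?M))" by (simp only: of_nat_le_iff)
    then show "real ?N / 2 \<le> real (?N - ?M)" by simp
  qed simp
  also have "\<dots> = (\<Sum>i\<in>{?M..<?N}. 2 powr (- (real (depth (Suc k)) * t)))" by simp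
  also have "\<dots> = (\<Sum>i\<in>{?M..<?N}. branch_len i powr t)"
    by (intro sum.cong) (auto simp: branch_len_powr block_of_eq)
  also have "\<dots> \<le> example.moment 0 t"
    unfolding moment_0_eq by (intro sum_le_suminf summable_branch_len_powr assms) auto
  finally show ?thesis .
qed

lemma pressure_le:
  assumes "0 < t" "example.moment 0 t \<le> 2 powr y"
  shows "example.pressure t \<le> y * ln 2"
proof -
  have "ln (example.moment 0 t) \<le> ln (2 powr y)"
    using assms example.moment_pos[OF assms(1), of 0] by (subst ln_le_cancel_iff) auto
  then show ?thesis by (simp add: example.pressure_def ln_powr)
qed

lemma pressure_ge:
  assumes "0 < t" "2 powr y \<le> example.moment 0 t"
  shows "y * ln 2 \<le> example.pressure t"
proof -
  have "ln (2 powr y) \<le> ln (example.moment 0 t)"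
    using assms example.moment_pos[OF assms(1), of 0] by (subst ln_le_cancel_iff) auto
  then show ?thesis by (simp add: example.pressure_def ln_powr)
qed

lemma depth_crit_scale: "depth k * crit_scale k = block_exp k / 10"
  by (simp add: depth_def crit_scale_def field_simps)

text \<open>Let \<open>B = block_exp (Suc k)\<close>. Up to small errors, the pressure at \<open>c * t\<close> is
  \<open>(1 - c / 10) * B * ln 2\<close>, that is \<open>0.9\<close>, \<open>0.5\<close> and \<open>0.1\<close> times \<open>B * ln 2\<close> for \<open>c = 1, 5, 9\<close>. The errors
  are at most \<open>0.05 * B * ln 2\<close>, which leaves \<open>sqrt 0.95 + sqrt 0.15 < 2 * sqrt 0.47\<close>.\<close>

lemma sqrt_pressure_not_midpoint_convex:
  fixes k :: nat
  defines "t \<equiv> crit_scale (Suc k)"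
  shows "sqrt (example.pressure t) + sqrt (example.pressure (9 * t)) < 2 * sqrt (example.pressure (5 * t))"
proof -
  define B where "B = real (block_exp (Suc k))"
  have t: "0 < t" by (simp add: t_def crit_scale_pos)
  have dt: "real (depth (Suc k)) * (c * t) = c * (B / 10)" for c
    using depth_crit_scale[of "Suc k"] by (simp add: t_def B_def)
  have "B = 100 * (100 * 100 ^ k)" by (simp add: B_def block_exp_def)
  moreover have "(1::real) \<le> 100 ^ k" by simp
  ultimately have B: "10000 \<le> B" by simp
  have prev: "real (block_exp k) = B / 100" by (simp add: B_def block_exp_def)
  have upper: "example.pressure (c * t) \<le> (y + 1 / 20) * B * ln 2"
    if "1 \<le> c" "1 / 100 \<le> y" "1 - c / 10 \<le> y" for c y
  proof (rule pressure_le)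
    show "0 < c * t" using that t by simp
    have "example.moment 0 (c * t) \<le> 2 ^ block_exp k + 2 powr (B - c * (B / 10)) + 2"
      using moment_0_upper[of k "c * t"] that t unfolding dt B_def[symmetric] by (simp add: t_def)
    moreover have "(2::real) ^ block_exp k \<le> 2 powr (y * B)"
      unfolding powr_realpow[symmetric, OF zero_less_numeral] prev
      using mult_right_mono[OF that(2), of B] B by (intro powr_mono) auto
    moreover have "2 powr (B - c * (B / 10)) \<le> 2 powr (y * B)"
      using mult_right_mono[OF that(3), of B] B by (intro powr_mono) (auto simp: algebra_simps)
    moreover have "1 \<le> 2 powr (y * B)"
      using that B by (intro ge_one_powr_ge_zero) auto
    ultimately have "example.moment 0 (c * t) \<le> 4 * 2 powr (y * B)" by linarith
    then have "example.moment 0 (c * t) \<le> 2 powr 2 * 2 powr (y * B)" by simp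
    also have "\<dots> = 2 powr (2 + y * B)" by (simp only: powr_add)
    also have "\<dots> \<le> 2 powr ((y + 1 / 20) * B)"
      using B by (intro powr_mono) (auto simp: algebra_simps)
    finally show "example.moment 0 (c * t) \<le> 2 powr ((y + 1 / 20) * B)" by simp
  qed
  have p1: "example.pressure t \<le> 95 / 100 * B * ln 2" using upper[of 1 "9 / 10"] by simp
  have p9: "example.pressure (9 * t) \<le> 15 / 100 * B * ln 2" using upper[of 9 "1 / 10"] by simp
  have p5: "47 / 100 * B * ln 2 \<le> example.pressure (5 * t)"
  proof (rule pressure_ge)
    have "2 powr (47 / 100 * B) \<le> 2 powr (B - 1 - 5 * (B / 10))"
      using B by (intro powr_mono) auto
    also have "\<dots> \<le> example.moment 0 (5 * t)"
      using moment_0_lower[of "5 * t" k] t unfolding dt B_def[symmetric] by simp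
    finally show "2 powr (47 / 100 * B) \<le> example.moment 0 (5 * t)" .
  qed (use t in simp)
  define C where "C = sqrt (B * ln 2)"
  have C: "0 < C" using B by (simp add: C_def)
  have sq: "sqrt (c * B * ln 2) = sqrt c * C" for c
    by (simp add: C_def real_sqrt_mult mult.assoc)
  have "sqrt (example.pressure t) \<le> sqrt (95 / 100) * C"
    using real_sqrt_le_mono[OF p1] unfolding sq .
  moreover have "sqrt (example.pressure (9 * t)) \<le> sqrt (15 / 100) * C"
    using real_sqrt_le_mono[OF p9] unfolding sq .
  moreover have "sqrt (47 / 100) * C \<le> sqrt (example.pressure (5 * t))"
    using real_sqrt_le_mono[OF p5] unfolding sq .
  moreover have "sqrt (95 / 100) \<le> 975 / (1000 :: real)"
    by (rule real_le_lsqrt) (auto simp: power2_eq_square)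
  moreover have "sqrt (15 / 100) \<le> 388 / (1000 :: real)"
    by (rule real_le_lsqrt) (auto simp: power2_eq_square)
  moreover have "685 / (1000 :: real) \<le> sqrt (47 / 100)"
    by (rule real_le_rsqrt) (auto simp: power2_eq_square)
  ultimately have "sqrt (example.pressure t) \<le> 975 / 1000 * C" "sqrt (example.pressure (9 * t)) \<le> 388 / 1000 * C"
    "685 / 1000 * C \<le> sqrt (example.pressure (5 * t))"
    using C mult_right_mono[of _ _ C] by (meson less_imp_le order_trans)+
  then show ?thesis using C by linarith
qed

theorem corollary1p7:
  shows "\<exists>(X :: nat \<Rightarrow> real set) (T :: real \<Rightarrow> real). infinite_branch_pl_map X T \<and>
    (\<forall>k\<ge>2. infinite {\<alpha> \<in> interior (lyapunov_values X T).
        times_differentiable_at k (lyapunov_spectrum X T) \<alpha> \<and>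
        (deriv ^^ k) (lyapunov_spectrum X T) \<alpha> = 0})"
proof -
  obtain t0 where "0 < t0" "0 < example.pressure t0"
    using example.pressure_unbounded_at_0[of 0] by (meson greaterThanAtMost_iff order_refl)
  then interpret spectrum: spectrum_tail branch_len branch_left t0
    by unfold_locales
  have "\<exists>t>0. 9 * t < \<epsilon> \<and>
      sqrt (example.pressure t) + sqrt (example.pressure (9 * t)) < 2 * sqrt (example.pressure (5 * t))"
    if "0 < \<epsilon>" for \<epsilon>
  proof -
    obtain k where "crit_scale (Suc k) < \<epsilon> / 9" using crit_scale_less_ex[of "\<epsilon> / 9"] \<open>0 < \<epsilon>\<close> by auto
    then show ?thesis
      using sqrt_pressure_not_midpoint_convex[of k] crit_scale_pos[of "Suc k"]
      by (intro exI[of _ "crit_scale (Suc k)"]) auto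
  qed
  then have "infinite {\<alpha> \<in> interior (lyapunov_values example.X example.T).
      times_differentiable_at k (lyapunov_spectrum example.X example.T) \<alpha> \<and>
      (deriv ^^ k) (lyapunov_spectrum example.X example.T) \<alpha> = 0}" if "2 \<le> k" for k
    using that by (intro spectrum.infinite_zeros_of_higher_derivs)
  with example.infinite_branch_pl_map show ?thesis by blast
qed

end
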